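(* Let $f:\mathbb{R}\to\mathbb{R}$ be locally Lipschitz continuous, and suppose there exist two real sequences $\{a_n\},\{b_n\}$ with $a_n\le b_n$, $a_n\to-\infty$ and $b_n\to\infty$ as $n\to\infty$, such that $$f(a_n)\ge f(s)\ge f(b_n)\quad\text{for all } s\in[a_n,b_n].$$ Let $u_0\in L^\infty(\Omega)$ and choose $n\in\mathbb{N}$ such that $a_n\le u_0(x)\le b_n$ for a.e. $x\in\Omega$. Then Problem $(P)$ with initial data $u_0$ has a unique time-global solution $u\in C^1([0,\infty);L^\infty(\Omega))$. It satisfies $\int_\Omega u(x,t)\,dx=\int_\Omega u_0(x)\,dx$ for all $t\ge0$ and, for each $t\ge 0$, $$a_n\le u(x,t)\le b_n\quad\text{for a.e. }x\in\Omega.$$ Furthermore: (i) $\omega(u_0)$ is a nonempty compact connected set in $L^1(\Omega)$. (ii) Every $\varphi\in\omega(u_0)$ satisfies $a_n\le\varphi\le b_n$ a.e. in $\Omega$ and is a stationary solution of $(P)$; more precisely, $f(\varphi(x))-\langle f(\varphi)\rangle=0$ for a.e. $x\in\Omega$.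
   Context: $\Omega\subset\mathbb{R}^N$ ($N\ge1$) is a (nonempty) bounded open set, $|A|$ is the Lebesgue measure of $A$, and $\langle g\rangle:=\frac1{|\Omega|}\int_\Omega g\,dx$. Problem $(P)$: $u_t=f(u)-\langle f(u)\rangle$ for $t>0$, $u(0)=u_0$, viewed as an ordinary differential equation in $L^\infty(\Omega)$: a solution on $[0,T)$ is a function $u\in C^1([0,T);L^\infty(\Omega))$ with $u(0)=u_0$ and $\frac{du}{dt}=f(u)-\langle f(u)\rangle$. The $\omega$-limit set of $u_0$ is $$\omega(u_0):=\{\varphi\in L^1(\Omega):\ \exists\, t_n\to\infty \text{ with } u(t_n)\to\varphi \text{ in } L^1(\Omega)\text{ as }n\to\infty\},$$ where $u$ is the global solution with initial data $u_0$. *)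

theory Defs
  imports "HOL-Analysis.Analysis" "HOL-Probability.Essential_Supremum"
begin

definition mean_value :: "'a::euclidean_space set \<Rightarrow> ('a \<Rightarrow> real) \<Rightarrow> real" where
  "mean_value \<Omega> g = (1 / measure lebesgue \<Omega>) * (LINT x|lebesgue_on \<Omega>. g x)"

subsection \<open>The space \<open>L\<^sup>\<infinity>(\<Omega>)\<close> and the evolution problem\<close>

text \<open>Elements of \<open>L\<^sup>\<infinity>(\<Omega>)\<close> are represented by measurable functions, and equality in
  \<open>L\<^sup>\<infinity>(\<Omega>)\<close> is equality almost everywhere in \<open>\<Omega>\<close>.  Values outside \<open>\<Omega>\<close> are irrelevant.
  The norm is extended-real valued, with value \<open>\<infinity>\<close> for
  functions that are not essentially bounded.\<close>

definition Linf_norm :: "'a::euclidean_space set \<Rightarrow> ('a \<Rightarrow> real) \<Rightarrow> ereal" where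
  "Linf_norm \<Omega> g = esssup (lebesgue_on \<Omega>) (\<lambda>x. ereal \<bar>g x\<bar>)"

definition Linf :: "'a::euclidean_space set \<Rightarrow> ('a \<Rightarrow> real) set" where
  "Linf \<Omega> = {g \<in> borel_measurable (lebesgue_on \<Omega>). Linf_norm \<Omega> g < \<infinity>}"

text \<open>\<open>u \<in> C\<^sup>1(J; L\<^sup>\<infinity>(\<Omega>))\<close> with derivative \<open>u'\<close>; at an endpoint belonging to \<open>J\<close> the
  derivative is one-sided.\<close>

definition C1_Linf ::
    "'a::euclidean_space set \<Rightarrow> real set \<Rightarrow> (real \<Rightarrow> 'a \<Rightarrow> real) \<Rightarrow> (real \<Rightarrow> 'a \<Rightarrow> real) \<Rightarrow> bool" where
  "C1_Linf \<Omega> J u u' \<longleftrightarrow>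
     (\<forall>t\<in>J. u t \<in> Linf \<Omega> \<and> u' t \<in> Linf \<Omega>) \<and>
     (\<forall>t\<in>J. ((\<lambda>s. Linf_norm \<Omega> (\<lambda>x. (u s x - u t x) / (s - t) - u' t x)) \<longlongrightarrow> 0) (at t within J)) \<and>
     (\<forall>t\<in>J. ((\<lambda>s. Linf_norm \<Omega> (\<lambda>x. u' s x - u' t x)) \<longlongrightarrow> 0) (at t within J))"

definition solution_on ::
    "'a::euclidean_space set \<Rightarrow> (real \<Rightarrow> real) \<Rightarrow> ('a \<Rightarrow> real) \<Rightarrow> real set \<Rightarrow> (real \<Rightarrow> 'a \<Rightarrow> real) \<Rightarrow> bool" where
  "solution_on \<Omega> f u\<^sub>0 J u \<longleftrightarrow>
     (AE x in lebesgue_on \<Omega>. u 0 x = u\<^sub>0 x) \<and>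
     (\<exists>u'. C1_Linf \<Omega> J u u' \<and>
        (\<forall>t\<in>J. AE x in lebesgue_on \<Omega>.
            u' t x = f (u t x) - mean_value \<Omega> (\<lambda>y. f (u t y))))"

abbreviation global_solution ::
    "'a::euclidean_space set \<Rightarrow> (real \<Rightarrow> real) \<Rightarrow> ('a \<Rightarrow> real) \<Rightarrow> (real \<Rightarrow> 'a \<Rightarrow> real) \<Rightarrow> bool" where
  "global_solution \<Omega> f u\<^sub>0 u \<equiv> solution_on \<Omega> f u\<^sub>0 {0..} u"

subsection \<open>The metric space \<open>L\<^sup>1(\<Omega>)\<close> and omega-limit sets\<close>

text \<open>Here genuine equivalence classes modulo equality almost everywhere are used, so that
  \<open>L\<^sup>1(\<Omega>)\<close> is a metric space in the sense of the library.\<close>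

definition ae_class :: "'a::euclidean_space set \<Rightarrow> ('a \<Rightarrow> real) \<Rightarrow> ('a \<Rightarrow> real) set" where
  "ae_class \<Omega> g = {h \<in> borel_measurable (lebesgue_on \<Omega>). AE x in lebesgue_on \<Omega>. h x = g x}"

definition L1 :: "'a::euclidean_space set \<Rightarrow> ('a \<Rightarrow> real) set set" where
  "L1 \<Omega> = ae_class \<Omega> ` {g. integrable (lebesgue_on \<Omega>) g}"

text \<open>The choice of representatives is immaterial, see \<open>L1_dist_ae_class\<close>.\<close>

definition L1_dist :: "'a::euclidean_space set \<Rightarrow> ('a \<Rightarrow> real) set \<Rightarrow> ('a \<Rightarrow> real) set \<Rightarrow> real" where
  "L1_dist \<Omega> \<Phi> \<Psi> = (LINT x|lebesgue_on \<Omega>. \<bar>(SOME g. g \<in> \<Phi>) x - (SOME h. h \<in> \<Psi>) x\<bar>)"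

definition L1_topology :: "'a::euclidean_space set \<Rightarrow> ('a \<Rightarrow> real) set topology" where
  "L1_topology \<Omega> = Metric_space.mtopology (L1 \<Omega>) (L1_dist \<Omega>)"

text \<open>The set \<open>\<omega>(u\<^sub>0)\<close>.  The global solution is only determined up to equality almost everywhere
  at each time, whence the quantifier over \<open>u\<close>.\<close>

definition omega_limit ::
    "'a::euclidean_space set \<Rightarrow> (real \<Rightarrow> real) \<Rightarrow> ('a \<Rightarrow> real) \<Rightarrow> ('a \<Rightarrow> real) set set" where
  "omega_limit \<Omega> f u\<^sub>0 = {\<Phi> \<in> L1 \<Omega>. \<exists>u t. global_solution \<Omega> f u\<^sub>0 u \<and>
      filterlim t at_top sequentially \<and>
      limitin (L1_topology \<Omega>) (\<lambda>k::nat. ae_class \<Omega> (u (t k))) \<Phi> sequentially}"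

lemma ae_class_some:
  assumes "g \<in> borel_measurable (lebesgue_on \<Omega>)"
  shows "(SOME h. h \<in> ae_class \<Omega> g) \<in> borel_measurable (lebesgue_on \<Omega>)"
    and "AE x in lebesgue_on \<Omega>. (SOME h. h \<in> ae_class \<Omega> g) x = g x"
proof -
  have "g \<in> ae_class \<Omega> g"
    using assms by (simp add: ae_class_def)
  then have "(SOME h. h \<in> ae_class \<Omega> g) \<in> ae_class \<Omega> g"
    by (rule someI[where P = "\<lambda>h. h \<in> ae_class \<Omega> g"])
  then show "(SOME h. h \<in> ae_class \<Omega> g) \<in> borel_measurable (lebesgue_on \<Omega>)"
    and "AE x in lebesgue_on \<Omega>. (SOME h. h \<in> ae_class \<Omega> g) x = g x"
    by (simp_all add: ae_class_def)
qed

lemma L1_dist_ae_class: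
  assumes [measurable]: "g \<in> borel_measurable (lebesgue_on \<Omega>)" "h \<in> borel_measurable (lebesgue_on \<Omega>)"
  shows "L1_dist \<Omega> (ae_class \<Omega> g) (ae_class \<Omega> h) = (LINT x|lebesgue_on \<Omega>. \<bar>g x - h x\<bar>)"
  unfolding L1_dist_def
proof (rule integral_cong_AE)
  note [measurable] = ae_class_some(1)[OF assms(1)] ae_class_some(1)[OF assms(2)]
  show "(\<lambda>x. \<bar>(SOME k. k \<in> ae_class \<Omega> g) x - (SOME k. k \<in> ae_class \<Omega> h) x\<bar>)
      \<in> borel_measurable (lebesgue_on \<Omega>)"
    by measurable
  show "(\<lambda>x. \<bar>g x - h x\<bar>) \<in> borel_measurable (lebesgue_on \<Omega>)"
    by measurable
  show "AE x in lebesgue_on \<Omega>.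
      \<bar>(SOME k. k \<in> ae_class \<Omega> g) x - (SOME k. k \<in> ae_class \<Omega> h) x\<bar> = \<bar>g x - h x\<bar>"
    using ae_class_some(2)[OF assms(1)] ae_class_some(2)[OF assms(2)] by eventually_elim simp
qed

lemma ae_class_eq_iff:
  assumes "g \<in> borel_measurable (lebesgue_on \<Omega>)" "h \<in> borel_measurable (lebesgue_on \<Omega>)"
  shows "ae_class \<Omega> g = ae_class \<Omega> h \<longleftrightarrow> (AE x in lebesgue_on \<Omega>. g x = h x)"
proof
  assume "ae_class \<Omega> g = ae_class \<Omega> h"
  moreover have "g \<in> ae_class \<Omega> g"
    using assms by (simp add: ae_class_def)
  ultimately show "AE x in lebesgue_on \<Omega>. g x = h x"
    by (simp add: ae_class_def)
next
  assume gh: "AE x in lebesgue_on \<Omega>. g x = h x"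
  have "(AE x in lebesgue_on \<Omega>. k x = g x) \<longleftrightarrow> (AE x in lebesgue_on \<Omega>. k x = h x)" for k
    by (rule eventually_subst) (use gh in \<open>eventually_elim, simp\<close>)
  then show "ae_class \<Omega> g = ae_class \<Omega> h"
    by (simp add: ae_class_def)
qed

lemma Metric_space_L1: "Metric_space (L1 \<Omega>) (L1_dist \<Omega>)"
proof
  show "0 \<le> L1_dist \<Omega> \<Phi> \<Psi>" for \<Phi> \<Psi>
    by (simp add: L1_dist_def)
  show "L1_dist \<Omega> \<Phi> \<Psi> = L1_dist \<Omega> \<Psi> \<Phi>" for \<Phi> \<Psi>
    by (simp add: L1_dist_def abs_minus_commute)
next
  fix \<Phi> \<Psi> assume "\<Phi> \<in> L1 \<Omega>" "\<Psi> \<in> L1 \<Omega>"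
  then obtain g h where g: "integrable (lebesgue_on \<Omega>) g" "\<Phi> = ae_class \<Omega> g"
    and h: "integrable (lebesgue_on \<Omega>) h" "\<Psi> = ae_class \<Omega> h"
    by (auto simp: L1_def)
  have m: "g \<in> borel_measurable (lebesgue_on \<Omega>)" "h \<in> borel_measurable (lebesgue_on \<Omega>)"
    using g h by auto
  have "integrable (lebesgue_on \<Omega>) (\<lambda>x. \<bar>g x - h x\<bar>)"
    using g h by simp
  from integral_nonneg_eq_0_iff_AE[OF this]
  have "(LINT x|lebesgue_on \<Omega>. \<bar>g x - h x\<bar>) = 0 \<longleftrightarrow> (AE x in lebesgue_on \<Omega>. g x = h x)"
    by simp
  then show "L1_dist \<Omega> \<Phi> \<Psi> = 0 \<longleftrightarrow> \<Phi> = \<Psi>"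
    by (simp add: g h L1_dist_ae_class[OF m] ae_class_eq_iff[OF m])
next
  fix \<Phi> \<Psi> \<Xi> assume "\<Phi> \<in> L1 \<Omega>" "\<Psi> \<in> L1 \<Omega>" "\<Xi> \<in> L1 \<Omega>"
  then obtain g h k where g: "integrable (lebesgue_on \<Omega>) g" "\<Phi> = ae_class \<Omega> g"
    and h: "integrable (lebesgue_on \<Omega>) h" "\<Psi> = ae_class \<Omega> h"
    and k: "integrable (lebesgue_on \<Omega>) k" "\<Xi> = ae_class \<Omega> k"
    by (auto simp: L1_def)
  have "(LINT x|lebesgue_on \<Omega>. \<bar>g x - k x\<bar>)
      \<le> (LINT x|lebesgue_on \<Omega>. \<bar>g x - h x\<bar> + \<bar>h x - k x\<bar>)"
    using g h k by (intro integral_mono) auto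
  also have "\<dots> = (LINT x|lebesgue_on \<Omega>. \<bar>g x - h x\<bar>) + (LINT x|lebesgue_on \<Omega>. \<bar>h x - k x\<bar>)"
    using g h k by (intro Bochner_Integration.integral_add) auto
  finally show "L1_dist \<Omega> \<Phi> \<Xi> \<le> L1_dist \<Omega> \<Phi> \<Psi> + L1_dist \<Omega> \<Psi> \<Xi>"
    using g h k by (simp add: L1_dist_ae_class borel_measurable_integrable)
qed

end

theory Submission
  imports Defs "HOL-Probability.Helly_Selection" "HOL-Complex_Analysis.Great_Picard"
begin

text \<open>Replace \<open>f\<close> by \<open>g = f \<circ> clip\<close>, where \<open>clip\<close> is the projection onto \<open>[a\<^sub>n, b\<^sub>n]\<close>, and solve
  \<open>\<partial>\<^sub>t Y(t, s) = g (Y(t, s)) - \<langle>g (Y(t, u\<^sub>0))\<rangle>\<close>, \<open>Y(0, s) = clip s\<close>, as an ordinary differential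
  equation in the Banach space of bounded continuous functions of \<open>s\<close>; then \<open>u(t, x) = Y(t, u\<^sub>0 x)\<close>.
  Since \<open>f(b\<^sub>n) \<le> \<langle>g\<rangle> \<le> f(a\<^sub>n)\<close>, scalar comparison keeps \<open>Y\<close> in \<open>[a\<^sub>n, b\<^sub>n]\<close>, so \<open>u\<close> solves the
  original problem; uniqueness is Gronwall's inequality for the squared \<open>L\<^sup>2\<close> distance.

  Comparison also makes \<open>Y(t, \<cdot>)\<close> nondecreasing. Hence by Helly's selection theorem every sequence
  \<open>Y(t\<^sub>k, \<cdot>)\<close> has a pointwise convergent subsequence, the orbit is relatively compact in \<open>L\<^sup>1\<close>,
  and its limit set is nonempty, compact and connected.

  If \<open>F' = g\<close>, then \<open>t \<mapsto> \<integral> F(u(t))\<close> is bounded and has derivative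
  \<open>\<integral> (f(u) - \<langle>f(u)\<rangle>)\<^sup>2 \<ge> 0\<close>. This derivative is Lipschitz in \<open>t\<close>, so it tends to \<open>0\<close>, and the
  limits of the orbit are stationary.\<close>

section \<open>Limit sets of precompact orbits\<close>

text \<open>Everything rests on \<open>subseq\<close>: sampling the orbit along any times tending to
  infinity leaves a subsequence converging to a point of \<open>W\<close>. Compactness follows by
  shadowing a sequence in \<open>W\<close> by such samples, connectedness because a connected tail
  of the orbit cannot jump between two separated pieces of \<open>W\<close>.\<close>

lemma (in Metric_space) orbit_limit_set:
  fixes u :: "real \<Rightarrow> 'a"
  assumes cont: "continuous_map euclideanreal mtopology u"
    and precompact: "\<And>t :: nat \<Rightarrow> real. filterlim t at_top sequentially \<Longrightarrow>
      \<exists>l r. strict_mono r \<and> limitin mtopology (\<lambda>k. u (t (r k))) l sequentially"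
    and W: "W = {l. \<exists>t. filterlim t at_top sequentially \<and>
      limitin mtopology (\<lambda>k::nat. u (t k)) l sequentially}"
  shows "W \<noteq> {}" and "compactin mtopology W" and "connectedin mtopology W"
proof -
  have subseq: "\<exists>l r. l \<in> W \<and> strict_mono r \<and> limitin mtopology (\<lambda>k. u (t (r k))) l sequentially"
    if t: "filterlim t at_top sequentially" for t :: "nat \<Rightarrow> real"
  proof -
    obtain l r where r: "strict_mono r" and l: "limitin mtopology (\<lambda>k. u (t (r k))) l sequentially"
      using precompact[OF t] by blast
    have "filterlim (\<lambda>k. t (r k)) at_top sequentially"
      using t r filterlim_compose filterlim_subseq by blast
    then have "l \<in> W"
      unfolding W using l by blast
    then show ?thesis
      using r l by blast
  qed
  have uM: "u t \<in> M" for t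
    using cont by (auto simp: continuous_map_def)
  have WM: "W \<subseteq> M"
    unfolding W using limitin_mspace by blast
  show "W \<noteq> {}"
    using subseq[OF filterlim_real_sequentially] by blast
  have close: "\<exists>t\<ge>T. d (u t) l < e" if "l \<in> W" "e > 0" for l T e
  proof -
    obtain t where t: "filterlim t at_top sequentially"
      and l: "limitin mtopology (\<lambda>k::nat. u (t k)) l sequentially"
      using \<open>l \<in> W\<close> unfolding W by blast
    have "eventually (\<lambda>k. d (u (t k)) l < e) sequentially"
      using l \<open>e > 0\<close> unfolding limitin_metric by (auto elim: eventually_mono)
    moreover have "eventually (\<lambda>k. t k \<ge> T) sequentially"
      using t by (simp add: filterlim_at_top)
    ultimately have "eventually (\<lambda>k. d (u (t k)) l < e \<and> t k \<ge> T) sequentially"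
      by eventually_elim simp
    then show ?thesis
      using eventually_happens'[OF sequentially_bot] by blast
  qed
  show compact: "compactin mtopology W"
    unfolding compactin_sequentially
  proof (intro conjI allI impI WM)
    fix \<sigma> :: "nat \<Rightarrow> 'a" assume \<sigma>: "range \<sigma> \<subseteq> W"
    \<comment> \<open>The orbit shadows \<open>\<sigma>\<close> at times \<open>t k \<ge> k\<close>
      with an error tending to 0, so \<open>subseq\<close> can be applied to the shadow
      instead.\<close>
    have "\<exists>t\<ge>real k. d (u t) (\<sigma> k) < 1 / real (Suc k)" for k
      using close[of "\<sigma> k" "1 / real (Suc k)" "real k"] \<sigma> by auto
    then obtain t where t: "\<And>k. t k \<ge> real k" "\<And>k. d (u (t k)) (\<sigma> k) < 1 / real (Suc k)"
      by metis
    have "filterlim t at_top sequentially"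
      by (rule filterlim_at_top_mono[OF filterlim_real_sequentially]) (simp add: t)
    then obtain l r where l: "l \<in> W" and r: "strict_mono r"
      and lim: "limitin mtopology (\<lambda>k. u (t (r k))) l sequentially"
      using subseq by blast
    have "(\<lambda>k. d (u (t (r k))) l + 1 / real (Suc (r k))) \<longlonglongrightarrow> 0 + 0"
    proof (rule tendsto_add)
      show "(\<lambda>k. d (u (t (r k))) l) \<longlonglongrightarrow> 0"
        using lim by (simp add: limitin_metric_dist_null)
      show "(\<lambda>k. 1 / real (Suc (r k))) \<longlonglongrightarrow> 0"
        using LIMSEQ_subseq_LIMSEQ[OF LIMSEQ_inverse_real_of_nat r]
        by (simp add: o_def inverse_eq_divide)
    qed
    then have lim0: "(\<lambda>k. d (u (t (r k))) l + 1 / real (Suc (r k))) \<longlonglongrightarrow> 0"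
      by simp
    have "(\<lambda>k. d (\<sigma> (r k)) l) \<longlonglongrightarrow> 0"
    proof (rule tendsto_sandwich[OF _ _ tendsto_const lim0])
      show "\<forall>\<^sub>F k in sequentially. d (\<sigma> (r k)) l \<le> d (u (t (r k))) l + 1 / real (Suc (r k))"
      proof (intro always_eventually allI)
        fix k
        have "d (\<sigma> (r k)) l \<le> d (\<sigma> (r k)) (u (t (r k))) + d (u (t (r k))) l"
          by (rule triangle) (use \<sigma> l WM uM in auto)
        then show "d (\<sigma> (r k)) l \<le> d (u (t (r k))) l + 1 / real (Suc (r k))"
          using t(2)[of "r k"] by (simp add: commute)
      qed
    qed simp
    then have "limitin mtopology (\<sigma> \<circ> r) l sequentially"
      unfolding limitin_metric_dist_null using \<sigma> l WM by (auto simp: o_def intro!: always_eventually)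
    then show "\<exists>l r. l \<in> W \<and> strict_mono r \<and> limitin mtopology (\<sigma> \<circ> r) l sequentially"
      using l r by blast
  qed
  show "connectedin mtopology W"
    unfolding connectedin_closedin
  proof (intro conjI notI)
    show "W \<subseteq> topspace mtopology"
      using WM by simp
    assume "\<exists>E1 E2. closedin mtopology E1 \<and> closedin mtopology E2 \<and> W \<subseteq> E1 \<union> E2 \<and>
        E1 \<inter> E2 \<inter> W = {} \<and> E1 \<inter> W \<noteq> {} \<and> E2 \<inter> W \<noteq> {}"
    then obtain E1 E2 where E: "closedin mtopology E1" "closedin mtopology E2" "W \<subseteq> E1 \<union> E2"
        "E1 \<inter> E2 \<inter> W = {}" "E1 \<inter> W \<noteq> {}" "E2 \<inter> W \<noteq> {}"
      by blast
    have "compactin mtopology (E1 \<inter> W)" "compactin mtopology (E2 \<inter> W)"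
      using E compact by (auto intro: closed_Int_compactin)
    moreover have "disjnt (E1 \<inter> W) (E2 \<inter> W)"
      using E by (auto simp: disjnt_def)
    ultimately obtain U V where UV: "openin mtopology U" "openin mtopology V"
        "E1 \<inter> W \<subseteq> U" "E2 \<inter> W \<subseteq> V" "disjnt U V"
      using Hausdorff_space_compact_separation[OF Hausdorff_space_mtopology] by metis
    have visit: "\<exists>t\<ge>T. u t \<in> S" if "openin mtopology S" "l \<in> S" "l \<in> W" for S l T
    proof -
      obtain e where "e > 0" "mball l e \<subseteq> S"
        using \<open>openin mtopology S\<close> \<open>l \<in> S\<close> unfolding openin_mtopology by blast
      then show ?thesis
        using close[OF \<open>l \<in> W\<close> \<open>e > 0\<close>, of T] uM WM \<open>l \<in> W\<close> by (force simp: in_mball commute)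
    qed
    \<comment> \<open>The tail from time \<open>k\<close> is connected and meets both of the
      disjoint open sets, so it must leave their union. A limit of such exit points would lie in
      \<open>W\<close>, hence in the open set \<open>U \<union> V\<close>, which late exit points
      would then have to enter.\<close>
    have "\<exists>t\<ge>real k. u t \<notin> U \<union> V" for k :: nat
    proof (rule ccontr)
      assume "\<not> (\<exists>t\<ge>real k. u t \<notin> U \<union> V)"
      then have sub: "u ` {real k..} \<subseteq> U \<union> V"
        by auto
      have conn: "connectedin mtopology (u ` {real k..})"
        by (rule connectedin_continuous_map_image[OF cont]) simp
      have "U \<inter> u ` {real k..} \<noteq> {}" "V \<inter> u ` {real k..} \<noteq> {}"
        using E(5,6) UV(3,4) visit[OF UV(1), of _ "real k"] visit[OF UV(2), of _ "real k"]
        by (fastforce simp: image_iff)+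
      moreover have "U \<inter> V \<inter> u ` {real k..} = {}"
        using UV(5) by (auto simp: disjnt_def)
      ultimately have "\<not> connectedin mtopology (u ` {real k..})"
        unfolding connectedin not_not de_Morgan_conj using UV(1,2) sub by (intro disjI2 exI[of _ U] exI[of _ V] conjI)
      then show False
        using conn by contradiction
    qed
    then obtain t :: "nat \<Rightarrow> real" where "\<forall>k. t k \<ge> real k \<and> u (t k) \<notin> U \<union> V"
      using choice[of "\<lambda>k t. t \<ge> real k \<and> u t \<notin> U \<union> V"] by blast
    then have t: "\<And>k. t k \<ge> real k" "\<And>k. u (t k) \<notin> U \<union> V"
      by auto
    have "filterlim t at_top sequentially"
      by (rule filterlim_at_top_mono[OF filterlim_real_sequentially]) (simp add: t)
    then obtain l r where l: "l \<in> W"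
      and lim: "limitin mtopology (\<lambda>k. u (t (r k))) l sequentially"
      using subseq by blast
    have "l \<in> U \<union> V"
      using l E UV by blast
    then have "eventually (\<lambda>k. u (t (r k)) \<in> U \<union> V) sequentially"
      using lim UV unfolding limitin_def by blast
    then show False
      using t(2) by simp
  qed
qed

section \<open>Differential equations and inequalities\<close>

text \<open>Near \<open>t\<close> the half-line coincides with the compact interval
  \<open>{0..t + 1}\<close>, where the fundamental theorem of calculus applies.\<close>

lemma has_vector_derivative_integral_atLeast:
  fixes h :: "real \<Rightarrow> 'a::banach"
  assumes "continuous_on {0..} h" and "t \<ge> 0"
  shows "((\<lambda>t. integral {0..t} h) has_vector_derivative h t) (at t within {0..})"
proof -
  have "((\<lambda>t. integral {0..t} h) has_vector_derivative h t) (at t within {0..t + 1})"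
    using assms by (intro integral_has_vector_derivative continuous_on_subset[OF assms(1)]) auto
  moreover have "at t within {0..t + 1} = at t within {0..}"
    by (rule at_within_nhd[where S = "{..<t + 1}"]) auto
  ultimately show ?thesis
    by simp
qed

text \<open>Integrating the exponential bound gains a factor \<open>1 / K\<close>, and the weight
  \<open>exp (- K * t)\<close> cancels the growth. Both the boundedness and the contraction of the
  Picard operator come from this estimate.\<close>

lemma norm_integral_exp_bound:
  fixes h :: "real \<Rightarrow> 'a::banach"
  assumes h: "continuous_on {0..t} h" and "t \<ge> 0" and "K > 0" "C \<ge> 0"
    and bound: "\<And>s. s \<in> {0..t} \<Longrightarrow> norm (h s) \<le> C * exp (K * s)"
  shows "exp (- K * t) * norm (integral {0..t} h) \<le> C / K"
proof -
  have I: "((\<lambda>s. C * exp (K * s)) has_integral (C * exp (K * t) / K - C * exp (K * 0) / K)) {0..t}"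
  proof (rule fundamental_theorem_of_calculus)
    show "((\<lambda>s. C * exp (K * s) / K) has_vector_derivative C * exp (K * s)) (at s within {0..t})" for s
      unfolding has_real_derivative_iff_has_vector_derivative[symmetric]
      by (rule derivative_eq_intros refl | use \<open>K > 0\<close> in simp)+
  qed (use \<open>t \<ge> 0\<close> in simp)
  have "norm (integral {0..t} h) \<le> integral {0..t} (\<lambda>s. C * exp (K * s))"
    using h I bound
    by (intro integral_norm_bound_integral) (auto intro: integrable_continuous_real has_integral_integrable)
  also have "\<dots> \<le> C * exp (K * t) / K"
    unfolding integral_unique[OF I] using \<open>C \<ge> 0\<close> \<open>K > 0\<close> by simp
  finally have "exp (- K * t) * norm (integral {0..t} h) \<le> exp (- K * t) * (C * exp (K * t) / K)"
    by (intro mult_left_mono) auto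
  also have "\<dots> = C / K"
    by (simp add: exp_minus)
  finally show ?thesis .
qed

text \<open>The weight \<open>exp (- K * t)\<close> turns the Picard operator into a contraction on the whole
  half-line, so that no continuation argument is needed.\<close>

theorem lipschitz_ode_global_solution:
  fixes G :: "'a::banach \<Rightarrow> 'a"
  assumes G: "L-lipschitz_on UNIV G"
  obtains y where "y 0 = y0"
    and "\<And>t. t \<ge> 0 \<Longrightarrow> (y has_vector_derivative G (y t)) (at t within {0..})"
proof -
  have L: "L \<ge> 0"
    using G by (rule lipschitz_on_nonneg)
  \<comment> \<open>This choice makes the contraction factor \<open>L / K\<close> at most one half;
    the added 1 keeps \<open>K\<close> positive when \<open>L = 0\<close>.\<close>
  define K where "K = 2 * L + 1"
  have K: "K > 0" "L / K \<le> 1 / 2"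
    using L by (auto simp: K_def field_simps)
  have Gdist: "norm (G v - G w) \<le> L * norm (v - w)" for v w
    using lipschitz_onD[OF G] by (simp add: dist_norm)
  have Gcont: "continuous_on UNIV G"
    by (rule lipschitz_on_continuous_on[OF G])
  \<comment> \<open>The unknown \<open>z\<close> is a solution multiplied by the decaying weight, so
    it can be bounded although the solution may grow exponentially; \<open>h\<close> undoes the
    weight before applying \<open>G\<close>.\<close>
  define h :: "(real \<Rightarrow>\<^sub>C 'a) \<Rightarrow> real \<Rightarrow> 'a" where "h z s = G (exp (K * s) *\<^sub>R z s)" for z s
  have hcont: "continuous_on S (h z)" for z S
    unfolding h_def by (intro continuous_on_compose2[OF Gcont] continuous_intros) auto
  define P :: "(real \<Rightarrow>\<^sub>C 'a) \<Rightarrow> real \<Rightarrow> 'a"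
    where "P z t = exp (- K * t) *\<^sub>R (y0 + integral {0..t} (h z))" for z t
  have Ider: "((\<lambda>t. integral {0..t} (h z)) has_vector_derivative h z t) (at t within {0..})"
    if "t \<ge> 0" for z t
    using hcont that by (rule has_vector_derivative_integral_atLeast)
  have Icont: "continuous_on {0..} (\<lambda>t. integral {0..t} (h z))" for z
    by (rule continuous_on_vector_derivative[OF Ider]) auto
  have Pcont: "continuous_on UNIV (\<lambda>t. P z (max 0 t))" for z
    unfolding P_def
    by (intro continuous_intros continuous_on_compose2[OF Icont]) auto
  have Pbound: "norm (P z (max 0 t)) \<le> norm y0 + (norm (G 0) + L * norm z) / K" for z t
  proof -
    define p where "p = max 0 t"
    have p: "p \<ge> 0"
      by (simp add: p_def)
    have "exp (- K * p) * norm (integral {0..p} (h z)) \<le> (norm (G 0) + L * norm z) / K"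
    proof (rule norm_integral_exp_bound[OF hcont p K(1)])
      fix s assume s: "s \<in> {0..p}"
      have "norm (h z s) \<le> norm (G 0) + norm (h z s - G 0)"
        by (metis add.commute diff_add_cancel norm_triangle_ineq)
      also have "\<dots> \<le> norm (G 0) + L * norm (exp (K * s) *\<^sub>R z s)"
        unfolding h_def using Gdist[of _ 0] by (metis add_left_mono diff_zero)
      also have "\<dots> \<le> norm (G 0) * exp (K * s) + L * (exp (K * s) * norm z)"
      proof (rule add_mono)
        have "1 \<le> exp (K * s)"
          using s K by simp
        then show "norm (G 0) \<le> norm (G 0) * exp (K * s)"
          using mult_left_mono[of 1 "exp (K * s)" "norm (G 0)"] by simp
        show "L * norm (exp (K * s) *\<^sub>R z s) \<le> L * (exp (K * s) * norm z)"
          using L norm_bounded[of z s] by (intro mult_left_mono) auto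
      qed
      finally show "norm (h z s) \<le> (norm (G 0) + L * norm z) * exp (K * s)"
        by (simp add: algebra_simps)
    qed (use L in simp)
    moreover have "exp (- K * p) * norm y0 \<le> 1 * norm y0"
      using p K by (intro mult_right_mono) auto
    moreover have "norm (P z p) \<le> exp (- K * p) * (norm y0 + norm (integral {0..p} (h z)))"
      unfolding P_def by (simp add: norm_triangle_ineq)
    ultimately show ?thesis
      unfolding p_def[symmetric] by (simp add: algebra_simps)
  qed
  \<comment> \<open>The elements of the function space are defined on the whole line, so
    \<open>max 0 t\<close> continues the Picard image to negative times by its value at 0.\<close>
  define Q where "Q z = Bcontfun (\<lambda>t. P z (max 0 t))" for z
  have Q: "apply_bcontfun (Q z) t = P z (max 0 t)" for z t
    unfolding Q_def
    by (subst Bcontfun_inverse) (auto intro!: bcontfun_normI[OF Pcont] Pbound)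
  have "\<exists>!z. Q z = z"
  proof (rule banach_fix_type)
    show "\<forall>z w. dist (Q z) (Q w) \<le> (1 / 2) * dist z w"
    proof (intro allI dist_bound)
      fix z w :: "real \<Rightarrow>\<^sub>C 'a" and t :: real
      define p where "p = max 0 t"
      have p: "p \<ge> 0"
        by (simp add: p_def)
      have "dist (Q z t) (Q w t) = exp (- K * p) * norm (integral {0..p} (\<lambda>s. h z s - h w s))"
        using hcont[of "{0..p}" z] hcont[of "{0..p}" w]
        by (simp add: Q P_def p_def[symmetric] dist_norm scaleR_right_diff_distrib[symmetric]
            Henstock_Kurzweil_Integration.integral_diff integrable_continuous_real)
      also have "\<dots> \<le> L * dist z w / K"
      proof (rule norm_integral_exp_bound[OF _ p K(1)])
        show "continuous_on {0..p} (\<lambda>s. h z s - h w s)"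
          by (intro continuous_intros hcont)
        fix s
        have "norm (h z s - h w s) \<le> L * (exp (K * s) * dist (z s) (w s))"
          unfolding h_def
          using Gdist[of "exp (K * s) *\<^sub>R z s" "exp (K * s) *\<^sub>R w s"]
          by (simp add: scaleR_right_diff_distrib[symmetric] dist_norm)
        also have "\<dots> \<le> L * (exp (K * s) * dist z w)"
          using L dist_bounded[of z s w] by (intro mult_left_mono) auto
        finally show "norm (h z s - h w s) \<le> L * dist z w * exp (K * s)"
          by (simp add: algebra_simps)
      qed (use L in simp)
      also have "\<dots> = (L / K) * dist z w"
        by simp
      also have "\<dots> \<le> (1 / 2) * dist z w"
        using K by (intro mult_right_mono) auto
      finally show "dist (Q z t) (Q w t) \<le> (1 / 2) * dist z w" .
    qed
  qed auto
  then obtain z where z: "Q z = z"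
    by blast
  define y where "y t = y0 + integral {0..t} (h z)" for t
  have yz: "y t = exp (K * t) *\<^sub>R z t" if "t \<ge> 0" for t
  proof -
    have "z t = P z t"
      using Q[of z t] z that by simp
    then have "exp (K * t) *\<^sub>R z t = (exp (K * t) * exp (- (K * t))) *\<^sub>R y t"
      by (simp add: P_def y_def)
    then show ?thesis
      by (simp add: exp_minus)
  qed
  show ?thesis
  proof (rule that)
    show "y 0 = y0"
      by (simp add: y_def)
    show "(y has_vector_derivative G (y t)) (at t within {0..})" if "t \<ge> 0" for t
    proof -
      have "(y has_vector_derivative 0 + h z t) (at t within {0..})"
        unfolding y_def[abs_def]
        by (rule has_vector_derivative_add[OF has_vector_derivative_const Ider[OF that]])
      then show ?thesis
        by (simp add: h_def yz[OF that])
    qed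
  qed
qed

text \<open>Gronwall's argument, run only where \<open>w\<close> is negative: after the last time
  \<open>r\<close> at which \<open>w\<close> is nonnegative, \<open>w s * exp (- L * s)\<close> is
  nondecreasing, so it cannot be negative at \<open>t\<close>. Asking for the inequality only where
  \<open>w s < 0\<close> is what allows the comparison with the barriers of the truncated
  problem.\<close>

lemma nonneg_if_derivative_ge:
  fixes w w' :: "real \<Rightarrow> real"
  assumes der: "\<And>t. t \<ge> 0 \<Longrightarrow> (w has_real_derivative w' t) (at t within {0..})"
    and init: "w 0 \<ge> 0"
    and ge: "\<And>s. 0 \<le> s \<Longrightarrow> s \<le> t \<Longrightarrow> w s < 0 \<Longrightarrow> w' s \<ge> L * w s"
    and "t \<ge> 0"
  shows "w t \<ge> 0"
proof (rule ccontr)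
  assume "\<not> w t \<ge> 0"
  define S where "S = {s \<in> {0..t}. 0 \<le> w s}"
  have cont: "continuous_on {0..} w"
    using der by (intro DERIV_continuous_on) auto
  have "closed S"
    unfolding S_def
    by (intro continuous_on_closed_Collect_le continuous_intros continuous_on_subset[OF cont]) auto
  moreover have "S \<noteq> {}" "bdd_above S"
    using init \<open>t \<ge> 0\<close> by (auto simp: S_def)
  ultimately have "Sup S \<in> S"
    by (intro closed_contains_Sup)
  define r where "r = Sup S"
  have r: "0 \<le> r" "r < t" "0 \<le> w r"
    using \<open>Sup S \<in> S\<close> \<open>\<not> w t \<ge> 0\<close> by (auto simp: S_def r_def less_le)
  have neg: "w s < 0" if "r < s" "s \<le> t" for s
  proof (rule ccontr)
    assume "\<not> w s < 0"
    then have "s \<in> S"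
      using that r by (auto simp: S_def)
    then have "s \<le> r"
      unfolding r_def using \<open>bdd_above S\<close> by (rule cSup_upper)
    then show False
      using that by simp
  qed
  have "w r * exp (- L * r) \<le> w t * exp (- L * t)"
  proof (rule DERIV_nonneg_imp_increasing_open[where f = "\<lambda>s. w s * exp (- L * s)"])
    show "r \<le> t"
      using r by simp
    show "continuous_on {r..t} (\<lambda>s. w s * exp (- L * s))"
      using r by (intro continuous_intros continuous_on_subset[OF cont]) auto
    fix s assume s: "r < s" "s < t"
    have "at s within {0..} = at s"
      using s r by (intro at_within_interior) auto
    then have "(w has_real_derivative w' s) (at s)"
      using der[of s] s r by simp
    then have "((\<lambda>s. w s * exp (- L * s)) has_real_derivative (w' s - L * w s) * exp (- L * s)) (at s)"
      by (auto intro!: derivative_eq_intros simp: algebra_simps)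
    moreover have "0 \<le> (w' s - L * w s) * exp (- L * s)"
      using ge[of s] neg[of s] s r by simp
    ultimately show "\<exists>d. ((\<lambda>s. w s * exp (- L * s)) has_real_derivative d) (at s) \<and> 0 \<le> d"
      by blast
  qed
  moreover have "0 \<le> w r * exp (- L * r)"
    using r by simp
  moreover have "w t * exp (- L * t) < 0"
    using neg[of t] r by (simp add: mult_less_0_iff)
  ultimately show False
    by simp
qed

section \<open>Pointwise compactness of monotone functions\<close>

text \<open>A second extraction handles the countably many discontinuities of the Helly limit, where
  the distribution of \<open>u\<^sub>0\<close> may have atoms.\<close>

lemma Helly_selection_pointwise:
  fixes g :: "nat \<Rightarrow> real \<Rightarrow> real"
  assumes cont: "\<And>n. continuous_on UNIV (g n)" and mono: "\<And>n. mono (g n)"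
    and bdd: "\<And>n x. \<bar>g n x\<bar> \<le> M"
  obtains r F where "strict_mono (r :: nat \<Rightarrow> nat)" and "\<And>x. (\<lambda>k. g (r k) x) \<longlonglongrightarrow> F x"
proof -
  have "continuous (at_right x) (g n)" for n x
    using cont[of n] by (simp add: continuous_on_eq_continuous_at continuous_at_imp_continuous_at_within)
  from Helly_selection[where f = g, OF this mono bdd] obtain r1 F1
    where r1: "strict_mono (r1 :: nat \<Rightarrow> nat)" and "mono F1"
      and F1: "\<And>x. isCont F1 x \<Longrightarrow> (\<lambda>k. g (r1 k) x) \<longlonglongrightarrow> F1 x"
    by blast
  define S where "S = {x. \<not> isCont F1 x}"
  have "countable S"
    unfolding S_def by (rule mono_ctble_discont[OF \<open>mono F1\<close>])
  then obtain r2 where r2: "strict_mono (r2 :: nat \<Rightarrow> nat)"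
    and S: "\<And>x. x \<in> S \<Longrightarrow> \<exists>l. (\<lambda>k. g (r1 (r2 k)) x) \<longlonglongrightarrow> l"
    using function_convergent_subsequence[of S "\<lambda>k. g (r1 k)" M] bdd by auto
  have "\<exists>l. (\<lambda>k. g (r1 (r2 k)) x) \<longlonglongrightarrow> l" for x
  proof (cases "x \<in> S")
    case False
    then have "(\<lambda>k. g (r1 k) x) \<longlonglongrightarrow> F1 x"
      using F1 by (simp add: S_def)
    from LIMSEQ_subseq_LIMSEQ[OF this r2] show ?thesis
      by (auto simp: o_def)
  qed (rule S)
  then obtain F where "\<And>x. (\<lambda>k. g (r1 (r2 k)) x) \<longlonglongrightarrow> F x"
    by metis
  moreover have "strict_mono (\<lambda>k. r1 (r2 k))"
    using r1 r2 by (simp add: strict_mono_def)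
  ultimately show ?thesis
    using that by blast
qed

section \<open>Continuously differentiable functions into \<open>L\<^sup>\<infinity>\<close>\<close>

text \<open>Compactness of the interval merges the local constants. To apply the result on
  \<open>local_lipschitz\<close>, \<open>f\<close> is treated as a field over the one-point time set
  \<open>{0}\<close>.\<close>

lemma lipschitz_on_Icc_if_locally:
  fixes f :: "real \<Rightarrow> real"
  assumes "\<And>s. \<exists>r>0. \<exists>L. L-lipschitz_on (cball s r) f"
  obtains L where "L-lipschitz_on {p..q} f"
proof -
  have "local_lipschitz {0::real} {p..q} (\<lambda>_. f)"
    unfolding local_lipschitz_def using assms by (force intro: lipschitz_on_subset)
  from local_lipschitz_compact_implies_lipschitz[OF this] show ?thesis
    using that by (metis compact_Icc compact_sing continuous_on_const singletonI)
qed

lemma continuous_on_if_locally_lipschitz: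
  fixes f :: "real \<Rightarrow> real"
  assumes "\<And>s. \<exists>r>0. \<exists>L. L-lipschitz_on (cball s r) f"
  shows "continuous_on UNIV f"
  unfolding continuous_on_eq_continuous_at[OF open_UNIV]
proof
  fix s
  obtain r L where "r > 0" "L-lipschitz_on (cball s r) f"
    using assms by blast
  then have "continuous_on (ball s r) f"
    using lipschitz_on_continuous_on continuous_on_subset ball_subset_cball by blast
  then show "isCont f s"
    using \<open>r > 0\<close> by (simp add: continuous_on_eq_continuous_at)
qed

lemma antiderivative_UNIV:
  fixes f :: "real \<Rightarrow> real"
  assumes "continuous_on UNIV f"
  obtains F where "\<And>x. (F has_real_derivative f x) (at x)"
  using einterval_antiderivative[of "-\<infinity>" "\<infinity>" f] assms
  by (auto simp: continuous_on_eq_continuous_at has_real_derivative_iff_has_vector_derivative)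

lemma continuous_bounded_on_abs_le:
  fixes f :: "real \<Rightarrow> real"
  assumes "continuous_on UNIV f"
  obtains D where "D > 0" and "\<And>z. \<bar>z\<bar> \<le> c \<Longrightarrow> \<bar>f z\<bar> \<le> D"
proof -
  have "bounded (f ` {- c..c})"
    by (intro compact_imp_bounded compact_continuous_image continuous_on_subset[OF assms]) auto
  then obtain D where "D > 0" "\<forall>y\<in>f ` {- c..c}. norm y \<le> D"
    unfolding bounded_pos by blast
  moreover have "f z \<in> f ` {- c..c}" if "\<bar>z\<bar> \<le> c" for z
    using that by (intro imageI) (simp add: abs_le_iff minus_le_iff)
  ultimately show ?thesis
    using that by (metis real_norm_def)
qed

section \<open>Essential bounds and the norm of L-infinity\<close>

lemma AE_abs_le_Linf_norm_less:
  assumes "Linf_norm \<Omega> g < ereal e"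
  shows "AE x in lebesgue_on \<Omega>. \<bar>g x\<bar> \<le> e"
  using esssup_AE[of "\<lambda>x. ereal \<bar>g x\<bar>" "lebesgue_on \<Omega>"]
proof eventually_elim
  fix x assume "ereal \<bar>g x\<bar> \<le> esssup (lebesgue_on \<Omega>) (\<lambda>x. ereal \<bar>g x\<bar>)"
  also have "\<dots> < ereal e"
    using assms by (simp only: Linf_norm_def)
  finally have "ereal \<bar>g x\<bar> < ereal e" .
  then show "\<bar>g x\<bar> \<le> e"
    by simp
qed

lemma LinfE:
  assumes "g \<in> Linf \<Omega>"
  obtains c where "c \<ge> 0" and "AE x in lebesgue_on \<Omega>. \<bar>g x\<bar> \<le> c"
proof -
  obtain c where "Linf_norm \<Omega> g < ereal c"
    using assms less_PInf_Ex_of_nat by (force simp: Linf_def)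
  from AE_abs_le_Linf_norm_less[OF this] have "AE x in lebesgue_on \<Omega>. \<bar>g x\<bar> \<le> \<bar>c\<bar>"
    by eventually_elim simp
  then show ?thesis
    using that[of "\<bar>c\<bar>"] by simp
qed

lemma Linf_AE_bounded: "g \<in> Linf \<Omega> \<Longrightarrow> \<exists>c. AE x in lebesgue_on \<Omega>. \<bar>g x\<bar> \<le> c"
  by (erule LinfE) blast

lemma Linf_norm_le:
  assumes [measurable]: "g \<in> borel_measurable (lebesgue_on \<Omega>)"
    and "AE x in lebesgue_on \<Omega>. \<bar>g x\<bar> \<le> c"
  shows "Linf_norm \<Omega> g \<le> ereal c"
  unfolding Linf_norm_def using assms(2) by (intro esssup_I) auto

lemma LinfI:
  assumes "g \<in> borel_measurable (lebesgue_on \<Omega>)" and "AE x in lebesgue_on \<Omega>. \<bar>g x\<bar> \<le> c"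
  shows "g \<in> Linf \<Omega>"
  using assms Linf_norm_le[OF assms] by (auto simp: Linf_def intro: le_less_trans)

lemma Linf_measurable: "g \<in> Linf \<Omega> \<Longrightarrow> g \<in> borel_measurable (lebesgue_on \<Omega>)"
  by (simp add: Linf_def)

lemma eventually_AE_abs_le:
  assumes "((\<lambda>s. Linf_norm \<Omega> (g s)) \<longlongrightarrow> 0) F" and "e > 0"
  shows "\<forall>\<^sub>F s in F. AE x in lebesgue_on \<Omega>. \<bar>g s x\<bar> \<le> e"
proof -
  have "\<forall>\<^sub>F s in F. Linf_norm \<Omega> (g s) < ereal e"
    using assms by (intro order_tendstoD(2)) auto
  then show ?thesis
    by eventually_elim (rule AE_abs_le_Linf_norm_less)
qed

lemma Linf_norm_tendsto_0:
  assumes pos: "measure lebesgue \<Omega> > 0"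
    and meas: "\<And>s. g s \<in> borel_measurable (lebesgue_on \<Omega>)"
    and le: "\<forall>\<^sub>F s in F. \<forall>x. \<bar>g s x\<bar> \<le> b s"
    and b: "(b \<longlongrightarrow> 0) F"
  shows "((\<lambda>s. Linf_norm \<Omega> (g s)) \<longlongrightarrow> 0) F"
proof (rule tendsto_sandwich[OF always_eventually _ tendsto_const])
  show "\<forall>\<^sub>F s in F. Linf_norm \<Omega> (g s) \<le> ereal (b s)"
    using le by eventually_elim (intro Linf_norm_le meas, simp)
  show "((\<lambda>s. ereal (b s)) \<longlongrightarrow> 0) F"
    using b by (simp add: zero_ereal_def)
  \<comment> \<open>On a null domain this essential supremum would be minus infinity; positive
    measure yields the lower bound 0 for the norm.\<close>
  have "esssup (lebesgue_on \<Omega>) (\<lambda>x. 0 :: ereal) = 0"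
  proof (rule esssup_const)
    have "\<Omega> \<in> sets lebesgue"
      using pos measure_notin_sets by force
    then show "emeasure (lebesgue_on \<Omega>) (space (lebesgue_on \<Omega>)) \<noteq> 0"
      using pos by (auto simp: space_restrict_space emeasure_restrict_space measure_def)
  qed
  moreover have "esssup (lebesgue_on \<Omega>) (\<lambda>x. 0 :: ereal) \<le> Linf_norm \<Omega> (g s)" for s
    unfolding Linf_norm_def by (intro esssup_mono) auto
  ultimately show "\<forall>s. 0 \<le> Linf_norm \<Omega> (g s)"
    by simp
qed

text \<open>The hypothesis \<open>quot\<close> says that \<open>u'\<close> is the derivative of \<open>u\<close> at \<open>t\<close> in the
  essential supremum norm.\<close>

lemma has_real_derivative_integral_comp:
  fixes u :: "real \<Rightarrow> 'a \<Rightarrow> real"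
  assumes "finite_measure M"
    and meas: "\<And>s. s \<in> J \<Longrightarrow> u s \<in> borel_measurable M" and "t \<in> J"
    and meas': "u' \<in> borel_measurable M"
    and R: "AE x in M. \<bar>u t x\<bar> \<le> R" and K: "AE x in M. \<bar>u' x\<bar> \<le> K"
    and quot: "\<And>e. e > 0 \<Longrightarrow>
      \<forall>\<^sub>F s in at t within J. AE x in M. \<bar>(u s x - u t x) / (s - t) - u' x\<bar> \<le> e"
    and \<Psi>: "\<And>z. (\<Psi> has_real_derivative \<psi> z) (at z)" and "continuous_on UNIV \<psi>"
  shows "((\<lambda>s. LINT x|M. \<Psi> (u s x)) has_real_derivative (LINT x|M. \<psi> (u t x) * u' x)) (at t within J)"
  \<comment> \<open>Passing to sequences makes dominated convergence applicable and leaves only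
    countably many exceptional null sets.\<close>
  unfolding has_field_derivative_iff tendsto_at_iff_sequentially
proof (intro allI impI)
  interpret finite_measure M by fact
  fix X assume X: "\<forall>k. X k \<in> J - {t}" "X \<longlonglongrightarrow> t"
  have \<Psi>cont: "continuous_on UNIV \<Psi>"
    using \<Psi> by (intro DERIV_continuous_on) (auto intro: has_field_derivative_at_within)
  note [measurable] = meas' borel_measurable_continuous_onI[OF \<Psi>cont]
    borel_measurable_continuous_onI[OF \<open>continuous_on UNIV \<psi>\<close>]
  have [measurable]: "u (X k) \<in> borel_measurable M" "u t \<in> borel_measurable M" for k
    using meas X(1) \<open>t \<in> J\<close> by auto
  define q where "q k x = (u (X k) x - u t x) / (X k - t)" for k x
  have uX: "u (X k) x = u t x + q k x * (X k - t)" for k x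
    using X(1)[rule_format, of k] by (simp add: q_def)
  have filt: "filterlim X (at t within J) sequentially"
    unfolding filterlim_at using X by (auto intro: always_eventually)
  have ev: "\<forall>\<^sub>F k in sequentially. AE x in M. \<bar>q k x - u' x\<bar> \<le> e" if "e > 0" for e
    using eventually_compose_filterlim[OF quot[OF that] filt] by (simp add: q_def)
  then have "\<exists>N. \<forall>k\<ge>N. AE x in M. \<bar>q k x - u' x\<bar> \<le> 1 / real (Suc m)" for m
    unfolding eventually_sequentially by simp
  then obtain N where N: "\<And>m k. k \<ge> N m \<Longrightarrow> AE x in M. \<bar>q k x - u' x\<bar> \<le> 1 / real (Suc m)"
    by metis
  \<comment> \<open>Each rate holds outside its own null set. Discarding their countable union lets
    almost every \<open>x\<close> satisfy all the rates at once.\<close>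
  have "AE x in M. k \<ge> N m \<longrightarrow> \<bar>q k x - u' x\<bar> \<le> 1 / real (Suc m)" for m k
    using N[of m k] by (cases "k \<ge> N m") auto
  then have "AE x in M. \<forall>m k. k \<ge> N m \<longrightarrow> \<bar>q k x - u' x\<bar> \<le> 1 / real (Suc m)"
    by (simp add: AE_all_countable)
  then have q_lim: "AE x in M. (\<lambda>k. q k x) \<longlonglongrightarrow> u' x"
  proof eventually_elim
    fix x assume x: "\<forall>m k. k \<ge> N m \<longrightarrow> \<bar>q k x - u' x\<bar> \<le> 1 / real (Suc m)"
    show "(\<lambda>k. q k x) \<longlonglongrightarrow> u' x"
      unfolding LIMSEQ_def
    proof (intro allI impI)
      fix e :: real assume "e > 0"
      then obtain m where m: "1 / real (Suc m) < e"
        using nat_approx_posE by blast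
      have "dist (q k x) (u' x) < e" if "k \<ge> N m" for k
        using x that m le_less_trans by (fastforce simp: dist_real_def)
      then show "\<exists>no. \<forall>k\<ge>no. dist (q k x) (u' x) < e"
        by blast
    qed
  qed
  have lim: "AE x in M. (\<lambda>k. (\<Psi> (u (X k) x) - \<Psi> (u t x)) / (X k - t)) \<longlonglongrightarrow> \<psi> (u t x) * u' x"
    using q_lim
  proof eventually_elim
    fix x assume x: "(\<lambda>k. q k x) \<longlonglongrightarrow> u' x"
    \<comment> \<open>Caratheodory's form of the derivative avoids dividing by
      \<open>u (X k) x - u t x\<close>, which may vanish.\<close>
    obtain g where g: "\<And>z. \<Psi> z - \<Psi> (u t x) = g z * (z - u t x)" "isCont g (u t x)"
        "g (u t x) = \<psi> (u t x)"
      using \<Psi>[of "u t x"] unfolding CARAT_DERIV by blast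
    have "(\<lambda>k. u t x + q k x * (X k - t)) \<longlonglongrightarrow> u t x + u' x * (t - t)"
      by (intro tendsto_intros x X)
    then have "(\<lambda>k. u (X k) x) \<longlonglongrightarrow> u t x"
      by (simp add: uX)
    then have "(\<lambda>k. g (u (X k) x)) \<longlonglongrightarrow> g (u t x)"
      using g(2) by (intro isCont_tendsto_compose[of _ g])
    then have "(\<lambda>k. g (u (X k) x) * q k x) \<longlonglongrightarrow> g (u t x) * u' x"
      using x by (rule tendsto_mult)
    then show "(\<lambda>k. (\<Psi> (u (X k) x) - \<Psi> (u t x)) / (X k - t)) \<longlonglongrightarrow> \<psi> (u t x) * u' x"
      using g by (simp add: q_def)
  qed
  \<comment> \<open>\<open>B\<close> allows for \<open>u t x\<close> and an increment of at most
    \<open>\<bar>K\<bar> + 1\<close>: this is the case once the quotient is within 1 of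
    \<open>u' x\<close> and \<open>\<bar>X k - t\<bar> < 1\<close>.\<close>
  define B where "B = \<bar>R\<bar> + \<bar>K\<bar> + 1"
  obtain C where C: "C > 0" "\<And>z. \<bar>z\<bar> \<le> B \<Longrightarrow> \<bar>\<psi> z\<bar> \<le> C"
    using continuous_bounded_on_abs_le[OF \<open>continuous_on UNIV \<psi>\<close>] by blast
  have \<Psi>lip: "\<bar>\<Psi> z - \<Psi> w\<bar> \<le> C * \<bar>z - w\<bar>" if "\<bar>z\<bar> \<le> B" "\<bar>w\<bar> \<le> B" for z w
    using field_differentiable_bound[of "{- B..B}" \<Psi> \<psi> C z w] that C(2)
    by (simp add: abs_le_iff minus_le_iff has_field_derivative_at_within[OF \<Psi>])
  have "\<forall>\<^sub>F k in sequentially. \<bar>X k - t\<bar> < 1"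
    using X(2) by (simp add: LIMSEQ_def eventually_sequentially dist_real_def)
  then obtain n where n: "\<And>k. k \<ge> n \<Longrightarrow> \<bar>X k - t\<bar> < 1"
      "\<And>k. k \<ge> n \<Longrightarrow> AE x in M. \<bar>q k x - u' x\<bar> \<le> 1"
    using ev[of 1] unfolding eventually_sequentially by (metis le_trans nle_le zero_less_one)
  have uB: "AE x in M. \<bar>u (X k) x\<bar> \<le> B \<and> \<bar>u t x\<bar> \<le> B \<and> \<bar>q k x\<bar> \<le> \<bar>K\<bar> + 1" if "k \<ge> n" for k
    using R K n(2)[OF that]
  proof eventually_elim
    fix x assume x: "\<bar>u t x\<bar> \<le> R" "\<bar>u' x\<bar> \<le> K" "\<bar>q k x - u' x\<bar> \<le> 1"
    then have q: "\<bar>q k x\<bar> \<le> \<bar>K\<bar> + 1"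
      by linarith
    have "\<bar>q k x * (X k - t)\<bar> \<le> \<bar>q k x\<bar> * 1"
      unfolding abs_mult using n(1)[OF that] by (intro mult_left_mono) auto
    then show "\<bar>u (X k) x\<bar> \<le> B \<and> \<bar>u t x\<bar> \<le> B \<and> \<bar>q k x\<bar> \<le> \<bar>K\<bar> + 1"
      using x q uX[of k x] unfolding B_def by linarith
  qed
  have bound: "AE x in M. norm ((\<Psi> (u (X (k + n)) x) - \<Psi> (u t x)) / (X (k + n) - t)) \<le> C * (\<bar>K\<bar> + 1)" for k
    using uB[OF le_add2]
  proof eventually_elim
    fix x assume x: "\<bar>u (X (k + n)) x\<bar> \<le> B \<and> \<bar>u t x\<bar> \<le> B \<and> \<bar>q (k + n) x\<bar> \<le> \<bar>K\<bar> + 1"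
    then have "\<bar>\<Psi> (u (X (k + n)) x) - \<Psi> (u t x)\<bar> / \<bar>X (k + n) - t\<bar>
        \<le> C * \<bar>u (X (k + n)) x - u t x\<bar> / \<bar>X (k + n) - t\<bar>"
      by (intro divide_right_mono \<Psi>lip) auto
    also have "\<dots> = C * \<bar>q (k + n) x\<bar>"
      by (simp add: q_def)
    also have "\<dots> \<le> C * (\<bar>K\<bar> + 1)"
      using x C by (intro mult_left_mono) auto
    finally show "norm ((\<Psi> (u (X (k + n)) x) - \<Psi> (u t x)) / (X (k + n) - t)) \<le> C * (\<bar>K\<bar> + 1)"
      by simp
  qed
  \<comment> \<open>The dominating constant is established only from index \<open>n\<close> on, so
    the sequence is shifted by \<open>n\<close>; \<open>LIMSEQ_offset\<close> removes the
    shift.\<close>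
  have "(\<lambda>k. LINT x|M. (\<Psi> (u (X (k + n)) x) - \<Psi> (u t x)) / (X (k + n) - t))
      \<longlonglongrightarrow> (LINT x|M. \<psi> (u t x) * u' x)"
  proof (rule integral_dominated_convergence[where w = "\<lambda>_. C * (\<bar>K\<bar> + 1)"])
    show "AE x in M. (\<lambda>k. (\<Psi> (u (X (k + n)) x) - \<Psi> (u t x)) / (X (k + n) - t)) \<longlonglongrightarrow> \<psi> (u t x) * u' x"
      using lim by eventually_elim (rule LIMSEQ_ignore_initial_segment)
    show "AE x in M. norm ((\<Psi> (u (X (k + n)) x) - \<Psi> (u t x)) / (X (k + n) - t)) \<le> C * (\<bar>K\<bar> + 1)" for k
      by (rule bound)
  qed auto
  moreover have "(LINT x|M. (\<Psi> (u (X (k + n)) x) - \<Psi> (u t x)) / (X (k + n) - t))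
      = ((LINT x|M. \<Psi> (u (X (k + n)) x)) - (LINT x|M. \<Psi> (u t x))) / (X (k + n) - t)" for k
  proof -
    obtain D where D: "\<And>z. \<bar>z\<bar> \<le> B \<Longrightarrow> \<bar>\<Psi> z\<bar> \<le> D"
      using continuous_bounded_on_abs_le[OF \<Psi>cont] by blast
    have "integrable M (\<lambda>x. \<Psi> (u (X (k + n)) x))"
      by (rule integrable_const_bound[where B = D])
        (use uB[of "k + n"] D in \<open>auto elim: eventually_mono\<close>)
    moreover have "integrable M (\<lambda>x. \<Psi> (u t x))"
      by (rule integrable_const_bound[where B = D])
        (use uB[of "k + n"] D in \<open>auto elim: eventually_mono\<close>)
    ultimately show ?thesis
      by simp
  qed
  ultimately have "(\<lambda>k. ((LINT x|M. \<Psi> (u (X (k + n)) x)) - (LINT x|M. \<Psi> (u t x))) / (X (k + n) - t))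
      \<longlonglongrightarrow> (LINT x|M. \<psi> (u t x) * u' x)"
    by (simp only:)
  from LIMSEQ_offset[OF this]
  show "((\<lambda>s. ((LINT x|M. \<Psi> (u s x)) - (LINT x|M. \<Psi> (u t x))) / (s - t)) \<circ> X)
      \<longlonglongrightarrow> (LINT x|M. \<psi> (u t x) * u' x)"
    by (simp add: o_def)
qed

text \<open>If the difference quotient is within 1 of \<open>u' t\<close> and
  \<open>\<bar>s - t\<bar> < 1\<close>, then \<open>u s\<close> differs from \<open>u t\<close> by
  at most \<open>K + 1\<close>. The second conclusion covers \<open>s = t\<close>, which the
  punctured filter omits.\<close>

lemma C1_Linf_locally_bounded:
  assumes C1: "C1_Linf \<Omega> J u u'" and "t \<in> J"
  obtains R where "\<forall>\<^sub>F s in at t within J. AE x in lebesgue_on \<Omega>. \<bar>u s x\<bar> \<le> R"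
    and "AE x in lebesgue_on \<Omega>. \<bar>u t x\<bar> \<le> R"
proof -
  obtain R where R: "AE x in lebesgue_on \<Omega>. \<bar>u t x\<bar> \<le> R"
    using C1 \<open>t \<in> J\<close> unfolding C1_Linf_def by (blast elim: LinfE)
  obtain K where K: "K \<ge> 0" "AE x in lebesgue_on \<Omega>. \<bar>u' t x\<bar> \<le> K"
    using C1 \<open>t \<in> J\<close> unfolding C1_Linf_def by (blast elim: LinfE)
  have "\<forall>\<^sub>F s in at t within J. \<bar>s - t\<bar> < 1"
    unfolding eventually_at by (intro exI[of _ 1]) (auto simp: dist_real_def)
  moreover have "\<forall>\<^sub>F s in at t within J.
      AE x in lebesgue_on \<Omega>. \<bar>(u s x - u t x) / (s - t) - u' t x\<bar> \<le> 1"
    using C1 \<open>t \<in> J\<close> unfolding C1_Linf_def by (intro eventually_AE_abs_le) auto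
  moreover have "\<forall>\<^sub>F s in at t within J. s \<noteq> t"
    by (simp add: eventually_at_filter)
  ultimately have "\<forall>\<^sub>F s in at t within J. AE x in lebesgue_on \<Omega>. \<bar>u s x\<bar> \<le> R + K + 1"
  proof eventually_elim
    fix s assume s: "\<bar>s - t\<bar> < 1" "s \<noteq> t"
      and "AE x in lebesgue_on \<Omega>. \<bar>(u s x - u t x) / (s - t) - u' t x\<bar> \<le> 1"
    from this(3) R K(2) show "AE x in lebesgue_on \<Omega>. \<bar>u s x\<bar> \<le> R + K + 1"
    proof eventually_elim
      fix x assume x: "\<bar>(u s x - u t x) / (s - t) - u' t x\<bar> \<le> 1" "\<bar>u t x\<bar> \<le> R" "\<bar>u' t x\<bar> \<le> K"
      then have "\<bar>(u s x - u t x) / (s - t)\<bar> \<le> K + 1"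
        by linarith
      then have "\<bar>u s x - u t x\<bar> \<le> (K + 1) * \<bar>s - t\<bar>"
        using s by (simp add: field_simps)
      also have "\<dots> \<le> (K + 1) * 1"
        using s K by (intro mult_left_mono) auto
      finally have "\<bar>u s x - u t x\<bar> \<le> K + 1"
        by simp
      then show "\<bar>u s x\<bar> \<le> R + K + 1"
        using x(2) by linarith
    qed
  qed
  moreover have "AE x in lebesgue_on \<Omega>. \<bar>u t x\<bar> \<le> R + K + 1"
    using R by eventually_elim (use K in linarith)
  ultimately show ?thesis
    using that by blast
qed

text \<open>Otherwise times \<open>s k\<close> violating the bound \<open>k\<close> accumulate at
  some point of \<open>S\<close>, against the local bound there. In the uniqueness proof this
  confines two solutions to a common range up to a given time.\<close>

lemma C1_Linf_bounded_on_compact: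
  assumes C1: "C1_Linf \<Omega> J u u'" and "compact S" and "S \<subseteq> J"
  obtains R where "\<And>s. s \<in> S \<Longrightarrow> AE x in lebesgue_on \<Omega>. \<bar>u s x\<bar> \<le> R"
proof (rule ccontr)
  assume "\<not> thesis"
  with that have "\<exists>s\<in>S. \<not> (AE x in lebesgue_on \<Omega>. \<bar>u s x\<bar> \<le> real k)" for k
    by blast
  then obtain s where s: "\<And>k. s k \<in> S" "\<And>k. \<not> (AE x in lebesgue_on \<Omega>. \<bar>u (s k) x\<bar> \<le> real k)"
    by metis
  obtain t r where t: "t \<in> S" and r: "strict_mono (r :: nat \<Rightarrow> nat)" and lim: "(s \<circ> r) \<longlonglongrightarrow> t"
    using \<open>compact S\<close> s(1) unfolding compact_def by metis
  obtain R where R: "\<forall>\<^sub>F s in at t within J. AE x in lebesgue_on \<Omega>. \<bar>u s x\<bar> \<le> R"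
      "AE x in lebesgue_on \<Omega>. \<bar>u t x\<bar> \<le> R"
    using C1_Linf_locally_bounded[OF C1] t \<open>S \<subseteq> J\<close> by blast
  obtain d where d: "d > 0" "\<And>s. s \<in> J \<Longrightarrow> dist s t < d \<Longrightarrow> AE x in lebesgue_on \<Omega>. \<bar>u s x\<bar> \<le> R"
    using R unfolding eventually_at by (metis)
  have "\<forall>\<^sub>F k in sequentially. dist ((s \<circ> r) k) t < d"
    using lim d(1) by (rule tendstoD)
  moreover have "\<forall>\<^sub>F k in sequentially. R \<le> real k"
    using filterlim_real_sequentially by (simp add: filterlim_at_top)
  ultimately have "\<forall>\<^sub>F k in sequentially. dist (s (r k)) t < d \<and> R \<le> real k"
    by eventually_elim simp
  then obtain k where k: "dist (s (r k)) t < d" "R \<le> real k"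
    using eventually_happens'[OF sequentially_bot] by blast
  have "AE x in lebesgue_on \<Omega>. \<bar>u (s (r k)) x\<bar> \<le> R"
    using d(2) k(1) s(1) \<open>S \<subseteq> J\<close> by blast
  then have "AE x in lebesgue_on \<Omega>. \<bar>u (s (r k)) x\<bar> \<le> real (r k)"
    by eventually_elim (use k(2) seq_suble[OF r, of k] in linarith)
  then show False
    using s(2) by blast
qed

section \<open>Mass conservation and uniqueness\<close>

lemma integrable_comp_Linf:
  fixes f :: "real \<Rightarrow> real"
  assumes "\<Omega> \<in> lmeasurable" and f: "continuous_on UNIV f" and g: "g \<in> Linf \<Omega>"
  shows "integrable (lebesgue_on \<Omega>) (\<lambda>x. f (g x))"
proof -
  interpret finite_measure "lebesgue_on \<Omega>"
    using assms(1) by (rule finite_measure_lebesgue_on)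
  note [measurable] = Linf_measurable[OF g] borel_measurable_continuous_onI[OF f]
  obtain c where c: "AE x in lebesgue_on \<Omega>. \<bar>g x\<bar> \<le> c"
    using g by (rule LinfE)
  obtain D where D: "\<And>z. \<bar>z\<bar> \<le> c \<Longrightarrow> \<bar>f z\<bar> \<le> D"
    using continuous_bounded_on_abs_le[OF f] by blast
  show ?thesis
    by (rule integrable_const_bound[where B = D]) (use c D in \<open>auto elim: eventually_mono\<close>)
qed

lemma integral_minus_mean_value:
  assumes "\<Omega> \<in> lmeasurable" and "measure lebesgue \<Omega> > 0" and "integrable (lebesgue_on \<Omega>) g"
  shows "(LINT x|lebesgue_on \<Omega>. g x - mean_value \<Omega> g) = 0"
proof -
  interpret finite_measure "lebesgue_on \<Omega>"
    using assms(1) by (rule finite_measure_lebesgue_on)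
  show ?thesis
    using assms by (simp add: mean_value_def measure_restrict_space fmeasurableD space_restrict_space)
qed

text \<open>Differentiating under the integral, with \<open>\<Psi>\<close> the identity, gives the
  integral of \<open>f (u s x)\<close> minus its mean, which vanishes.\<close>

lemma solution_integral_conserved:
  assumes \<Omega>: "\<Omega> \<in> lmeasurable" "measure lebesgue \<Omega> > 0"
    and f: "continuous_on UNIV f"
    and sol: "global_solution \<Omega> f u\<^sub>0 u" and "u\<^sub>0 \<in> Linf \<Omega>" and "t \<ge> 0"
  shows "(LINT x|lebesgue_on \<Omega>. u t x) = (LINT x|lebesgue_on \<Omega>. u\<^sub>0 x)"
proof -
  obtain u' where init: "AE x in lebesgue_on \<Omega>. u 0 x = u\<^sub>0 x" and C1: "C1_Linf \<Omega> {0..} u u'"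
    and eq: "\<And>t. t \<ge> 0 \<Longrightarrow>
      AE x in lebesgue_on \<Omega>. u' t x = f (u t x) - mean_value \<Omega> (\<lambda>y. f (u t y))"
    using sol unfolding solution_on_def by auto
  have Linf: "u s \<in> Linf \<Omega>" "u' s \<in> Linf \<Omega>" if "s \<ge> 0" for s
    using C1 that by (auto simp: C1_Linf_def)
  have der: "((\<lambda>s. LINT x|lebesgue_on \<Omega>. u s x) has_real_derivative 0) (at s within {0..})"
    if s: "s \<ge> 0" for s
  proof -
    obtain R K where "AE x in lebesgue_on \<Omega>. \<bar>u s x\<bar> \<le> R" "AE x in lebesgue_on \<Omega>. \<bar>u' s x\<bar> \<le> K"
      using Linf[THEN Linf_AE_bounded, OF s] by blast
    then have "((\<lambda>s. LINT x|lebesgue_on \<Omega>. u s x) has_real_derivative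
        (LINT x|lebesgue_on \<Omega>. 1 * u' s x)) (at s within {0..})"
      using C1 s \<Omega> Linf
      by (intro has_real_derivative_integral_comp[where \<Psi> = "\<lambda>z. z"])
        (auto simp: C1_Linf_def Linf_measurable intro!: finite_measure_lebesgue_on
          eventually_AE_abs_le continuous_intros)
    also have "(LINT x|lebesgue_on \<Omega>. 1 * u' s x)
        = (LINT x|lebesgue_on \<Omega>. f (u s x) - mean_value \<Omega> (\<lambda>y. f (u s y)))"
    proof (rule integral_cong_AE)
      show "(\<lambda>x. f (u s x) - mean_value \<Omega> (\<lambda>y. f (u s y))) \<in> borel_measurable (lebesgue_on \<Omega>)"
        using integrable_comp_Linf[OF \<Omega>(1) f Linf(1)[OF s]] by simp
    qed (use eq[OF s] Linf(2)[OF s] in \<open>auto simp: Linf_measurable\<close>)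
    also have "\<dots> = 0"
      by (rule integral_minus_mean_value[OF \<Omega> integrable_comp_Linf[OF \<Omega>(1) f Linf(1)[OF s]]])
    finally show ?thesis .
  qed
  have "(LINT x|lebesgue_on \<Omega>. u t x) = (LINT x|lebesgue_on \<Omega>. u 0 x)"
    using has_field_derivative_zero_constant[of "{0..}" "\<lambda>s. LINT x|lebesgue_on \<Omega>. u s x"] der \<open>t \<ge> 0\<close>
    by force
  also have "\<dots> = (LINT x|lebesgue_on \<Omega>. u\<^sub>0 x)"
    using init Linf(1)[of 0] assms(5) by (intro integral_cong_AE) (auto simp: Linf_measurable)
  finally show ?thesis .
qed

text \<open>The squared L^2 distance \<open>E\<close> has derivative at most
  \<open>2 * L * E\<close>. The nonlocal terms differ by a constant \<open>c\<close> in space and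
  contribute \<open>- 2 * c\<close> times the integral of \<open>w\<close>, which is 0 because both
  solutions keep the mass of \<open>u\<^sub>0\<close>.\<close>

lemma solution_unique:
  assumes \<Omega>: "\<Omega> \<in> lmeasurable" "measure lebesgue \<Omega> > 0"
    and f: "\<And>s. \<exists>r>0. \<exists>L. L-lipschitz_on (cball s r) f"
    and u0: "u\<^sub>0 \<in> Linf \<Omega>"
    and u: "global_solution \<Omega> f u\<^sub>0 u" and v: "global_solution \<Omega> f u\<^sub>0 v" and "t \<ge> 0"
  shows "AE x in lebesgue_on \<Omega>. v t x = u t x"
proof -
  interpret finite_measure "lebesgue_on \<Omega>"
    using \<Omega>(1) by (rule finite_measure_lebesgue_on)
  have fc: "continuous_on UNIV f"
    using f by (rule continuous_on_if_locally_lipschitz)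
  obtain u' where uinit: "AE x in lebesgue_on \<Omega>. u 0 x = u\<^sub>0 x" and uC1: "C1_Linf \<Omega> {0..} u u'"
    and ueq: "\<And>t. t \<ge> 0 \<Longrightarrow>
      AE x in lebesgue_on \<Omega>. u' t x = f (u t x) - mean_value \<Omega> (\<lambda>y. f (u t y))"
    using u unfolding solution_on_def by auto
  obtain v' where vinit: "AE x in lebesgue_on \<Omega>. v 0 x = u\<^sub>0 x" and vC1: "C1_Linf \<Omega> {0..} v v'"
    and veq: "\<And>t. t \<ge> 0 \<Longrightarrow>
      AE x in lebesgue_on \<Omega>. v' t x = f (v t x) - mean_value \<Omega> (\<lambda>y. f (v t y))"
    using v unfolding solution_on_def by auto
  have Linf: "u s \<in> Linf \<Omega>" "u' s \<in> Linf \<Omega>" "v s \<in> Linf \<Omega>" "v' s \<in> Linf \<Omega>" if "s \<ge> 0" for s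
    using uC1 vC1 that by (auto simp: C1_Linf_def)
  note meas = Linf[THEN Linf_measurable]
  have int_id: "integrable (lebesgue_on \<Omega>) g" if "g \<in> Linf \<Omega>" for g
    using integrable_comp_Linf[OF \<Omega>(1) continuous_on_id that] .
  obtain R1 where R1: "\<And>s. s \<in> {0..t} \<Longrightarrow> AE x in lebesgue_on \<Omega>. \<bar>u s x\<bar> \<le> R1"
    using C1_Linf_bounded_on_compact[OF uC1, of "{0..t}"] by auto
  obtain R2 where R2: "\<And>s. s \<in> {0..t} \<Longrightarrow> AE x in lebesgue_on \<Omega>. \<bar>v s x\<bar> \<le> R2"
    using C1_Linf_bounded_on_compact[OF vC1, of "{0..t}"] by auto
  \<comment> \<open>Up to time \<open>t\<close> both solutions lie almost everywhere in the interval
    from \<open>- R\<close> to \<open>R\<close>, on which \<open>f\<close> has a single Lipschitz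
    constant.\<close>
  define R where "R = max R1 R2"
  obtain L where L: "L-lipschitz_on {- R..R} f"
    using lipschitz_on_Icc_if_locally[OF f] by blast
  define w where "w s x = v s x - u s x" for s x
  define w' where "w' s x = v' s x - u' s x" for s x
  define E where "E s = (LINT x|lebesgue_on \<Omega>. (w s x)\<^sup>2)" for s
  have wLinf: "w s \<in> Linf \<Omega>" "w' s \<in> Linf \<Omega>" if s: "s \<ge> 0" for s
  proof -
    obtain c1 c2 c3 c4 where "AE x in lebesgue_on \<Omega>. \<bar>u s x\<bar> \<le> c1"
        "AE x in lebesgue_on \<Omega>. \<bar>v s x\<bar> \<le> c2"
        "AE x in lebesgue_on \<Omega>. \<bar>u' s x\<bar> \<le> c3" "AE x in lebesgue_on \<Omega>. \<bar>v' s x\<bar> \<le> c4"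
      using Linf[THEN Linf_AE_bounded, OF s] by blast
    then have "AE x in lebesgue_on \<Omega>. \<bar>w s x\<bar> \<le> c1 + c2 \<and> \<bar>w' s x\<bar> \<le> c3 + c4"
      by eventually_elim (auto simp: w_def w'_def)
    then show "w s \<in> Linf \<Omega>" "w' s \<in> Linf \<Omega>"
      using meas[OF s] unfolding w_def[abs_def] w'_def[abs_def]
      by (auto intro!: LinfI elim: eventually_mono)
  qed
  have der: "(E has_real_derivative (LINT x|lebesgue_on \<Omega>. 2 * w s x * w' s x)) (at s within {0..})"
    if s: "s \<ge> 0" for s
  proof -
    obtain c c' where "AE x in lebesgue_on \<Omega>. \<bar>w s x\<bar> \<le> c" "AE x in lebesgue_on \<Omega>. \<bar>w' s x\<bar> \<le> c'"
      using wLinf[THEN Linf_AE_bounded, OF s] by blast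
    moreover have "\<forall>\<^sub>F r in at s within {0..}.
        AE x in lebesgue_on \<Omega>. \<bar>(w r x - w s x) / (r - s) - w' s x\<bar> \<le> e" if "e > 0" for e
    proof -
      have "\<forall>\<^sub>F r in at s within {0..}.
          AE x in lebesgue_on \<Omega>. \<bar>(u r x - u s x) / (r - s) - u' s x\<bar> \<le> e / 2"
        using uC1 s that by (intro eventually_AE_abs_le) (auto simp: C1_Linf_def)
      moreover have "\<forall>\<^sub>F r in at s within {0..}.
          AE x in lebesgue_on \<Omega>. \<bar>(v r x - v s x) / (r - s) - v' s x\<bar> \<le> e / 2"
        using vC1 s that by (intro eventually_AE_abs_le) (auto simp: C1_Linf_def)
      ultimately show ?thesis
      proof eventually_elim
        fix r assume "AE x in lebesgue_on \<Omega>. \<bar>(u r x - u s x) / (r - s) - u' s x\<bar> \<le> e / 2"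
          "AE x in lebesgue_on \<Omega>. \<bar>(v r x - v s x) / (r - s) - v' s x\<bar> \<le> e / 2"
        then show "AE x in lebesgue_on \<Omega>. \<bar>(w r x - w s x) / (r - s) - w' s x\<bar> \<le> e"
        proof eventually_elim
          fix x
          have "(w r x - w s x) / (r - s) = (v r x - v s x) / (r - s) - (u r x - u s x) / (r - s)"
            by (simp add: w_def diff_divide_distrib[symmetric])
          then show "\<bar>(u r x - u s x) / (r - s) - u' s x\<bar> \<le> e / 2 \<Longrightarrow>
              \<bar>(v r x - v s x) / (r - s) - v' s x\<bar> \<le> e / 2 \<Longrightarrow>
              \<bar>(w r x - w s x) / (r - s) - w' s x\<bar> \<le> e"
            unfolding w'_def by linarith
        qed
      qed
    qed
    ultimately show ?thesis
      unfolding E_def using s wLinf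
      by (intro has_real_derivative_integral_comp[where \<Psi> = "\<lambda>z. z\<^sup>2" and \<psi> = "\<lambda>z. 2 * z"])
        (auto intro!: finite_measure_axioms continuous_intros derivative_eq_intros Linf_measurable)
  qed
  have Eder: "(LINT x|lebesgue_on \<Omega>. 2 * w s x * w' s x) \<le> 2 * L * E s" if s: "0 \<le> s" "s \<le> t" for s
  proof -
    define c where "c = mean_value \<Omega> (\<lambda>y. f (v s y)) - mean_value \<Omega> (\<lambda>y. f (u s y))"
    note [measurable] = wLinf[THEN Linf_measurable, OF s(1)]
    have int_w: "integrable (lebesgue_on \<Omega>) (w s)"
      using int_id wLinf(1)[OF s(1)] .
    have int_w2: "integrable (lebesgue_on \<Omega>) (\<lambda>x. (w s x)\<^sup>2)"
      by (rule integrable_comp_Linf[where f = "\<lambda>z. z\<^sup>2"])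
        (use \<Omega>(1) wLinf(1)[OF s(1)] in \<open>auto intro!: continuous_intros\<close>)
    have int_ww': "integrable (lebesgue_on \<Omega>) (\<lambda>x. 2 * w s x * w' s x)"
    proof -
      obtain d d' where "AE x in lebesgue_on \<Omega>. \<bar>w s x\<bar> \<le> d" "AE x in lebesgue_on \<Omega>. \<bar>w' s x\<bar> \<le> d'"
        using wLinf[THEN Linf_AE_bounded, OF s(1)] by blast
      then have "AE x in lebesgue_on \<Omega>. norm (2 * w s x * w' s x) \<le> 2 * d * d'"
        by eventually_elim (auto simp: abs_mult intro!: mult_mono)
      then show ?thesis
        by (rule integrable_const_bound) auto
    qed
    have "(LINT x|lebesgue_on \<Omega>. w s x) = 0"
    proof -
      have "(LINT x|lebesgue_on \<Omega>. w s x) = (LINT x|lebesgue_on \<Omega>. v s x) - (LINT x|lebesgue_on \<Omega>. u s x)"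
        unfolding w_def using int_id Linf[OF s(1)] by simp
      then show ?thesis
        using solution_integral_conserved[OF \<Omega> fc u u0 s(1)]
          solution_integral_conserved[OF \<Omega> fc v u0 s(1)] by simp
    qed
    moreover have "(LINT x|lebesgue_on \<Omega>. 2 * w s x * w' s x)
        \<le> (LINT x|lebesgue_on \<Omega>. 2 * L * (w s x)\<^sup>2 - 2 * c * w s x)"
    proof (rule integral_mono_AE[OF int_ww'])
      have "s \<in> {0..t}"
        using s by simp
      from R1[OF this] R2[OF this] ueq[OF s(1)] veq[OF s(1)]
      show "AE x in lebesgue_on \<Omega>. 2 * w s x * w' s x \<le> 2 * L * (w s x)\<^sup>2 - 2 * c * w s x"
      proof eventually_elim
        fix x assume x: "\<bar>u s x\<bar> \<le> R1" "\<bar>v s x\<bar> \<le> R2"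
          "u' s x = f (u s x) - mean_value \<Omega> (\<lambda>y. f (u s y))"
          "v' s x = f (v s x) - mean_value \<Omega> (\<lambda>y. f (v s y))"
        have w'_eq: "w' s x = f (v s x) - f (u s x) - c"
          using x by (simp add: w'_def c_def)
        have "\<bar>f (v s x) - f (u s x)\<bar> \<le> L * \<bar>w s x\<bar>"
        proof -
          have "v s x \<in> {- R..R}" "u s x \<in> {- R..R}"
            using x(1,2) by (auto simp: R_def)
          then show ?thesis
            using lipschitz_onD[OF L, of "v s x" "u s x"] by (simp add: dist_real_def w_def)
        qed
        then have "\<bar>w s x\<bar> * \<bar>f (v s x) - f (u s x)\<bar> \<le> \<bar>w s x\<bar> * (L * \<bar>w s x\<bar>)"
          by (intro mult_left_mono) auto
        then have "w s x * (f (v s x) - f (u s x)) \<le> \<bar>w s x\<bar> * (L * \<bar>w s x\<bar>)"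
          by (metis abs_ge_self abs_mult order_trans)
        moreover have "2 * w s x * w' s x = 2 * (w s x * (f (v s x) - f (u s x))) - 2 * c * w s x"
          unfolding w'_eq by (simp add: algebra_simps)
        moreover have "\<bar>w s x\<bar> * (L * \<bar>w s x\<bar>) = L * (w s x)\<^sup>2"
          by (simp add: power2_eq_square mult.left_commute)
        ultimately show "2 * w s x * w' s x \<le> 2 * L * (w s x)\<^sup>2 - 2 * c * w s x"
          by linarith
      qed
    qed (use int_w int_w2 in auto)
    ultimately show ?thesis
      using int_w int_w2 by (simp add: E_def)
  qed
  have "AE x in lebesgue_on \<Omega>. w 0 x = 0"
    using uinit vinit by eventually_elim (simp add: w_def)
  then have "E 0 = (LINT x|lebesgue_on \<Omega>. 0)"
    unfolding E_def using wLinf(1)[of 0, THEN Linf_measurable]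
    by (intro integral_cong_AE) (auto elim: eventually_mono)
  then have "E 0 = 0"
    by simp
  \<comment> \<open>The comparison lemma propagates lower bounds, so it is applied to
    \<open>- E\<close> in order to bound \<open>E\<close> above by 0.\<close>
  have "- E t \<ge> 0"
    by (rule nonneg_if_derivative_ge[where w = "\<lambda>s. - E s" and L = "2 * L"
          and w' = "\<lambda>s. - (LINT x|lebesgue_on \<Omega>. 2 * w s x * w' s x)"])
      (use der Eder \<open>E 0 = 0\<close> \<open>t \<ge> 0\<close> in \<open>auto intro!: DERIV_minus\<close>)
  moreover have "E t \<ge> 0"
    by (simp add: E_def)
  ultimately have "E t = 0"
    by simp
  moreover have "integrable (lebesgue_on \<Omega>) (\<lambda>x. (w t x)\<^sup>2)"
    by (rule integrable_comp_Linf[where f = "\<lambda>z. z\<^sup>2"])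
      (use \<Omega>(1) wLinf(1)[OF \<open>t \<ge> 0\<close>] in \<open>auto intro!: continuous_intros\<close>)
  ultimately have "AE x in lebesgue_on \<Omega>. (w t x)\<^sup>2 = 0"
    unfolding E_def by (subst (asm) integral_nonneg_eq_0_iff_AE) auto
  then show ?thesis
    by eventually_elim (simp add: w_def)
qed

section \<open>The flow of initial values\<close>

text \<open>Puts the bounded continuous functions of the initial value into the class over which
  \<open>lipschitz_ode_global_solution\<close> is stated.\<close>

instance bcontfun :: (metric_space, banach) banach ..

section \<open>Estimates for integrals and spatial means\<close>

lemma (in finite_measure) abs_integral_le_const:
  fixes g :: "'a \<Rightarrow> real"
  assumes "g \<in> borel_measurable M" and "\<And>x. \<bar>g x\<bar> \<le> c"
  shows "\<bar>LINT x|M. g x\<bar> \<le> c * measure M (space M)"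
proof -
  have "integrable M g"
    by (rule integrable_const_bound[where B = c]) (use assms in auto)
  then have "(LINT x|M. \<bar>g x\<bar>) \<le> (LINT x|M. c)"
    using assms(2) by (intro integral_mono) simp_all
  with integral_abs_bound[of M g] have "\<bar>LINT x|M. g x\<bar> \<le> (LINT x|M. c)"
    by (rule order_trans)
  then show ?thesis
    by (simp add: mult.commute)
qed

lemma mean_value_diff_le:
  assumes \<Omega>: "\<Omega> \<in> lmeasurable" "measure lebesgue \<Omega> > 0"
    and g: "integrable (lebesgue_on \<Omega>) g" and h: "integrable (lebesgue_on \<Omega>) h"
    and le: "\<And>x. \<bar>g x - h x\<bar> \<le> c"
  shows "\<bar>mean_value \<Omega> g - mean_value \<Omega> h\<bar> \<le> c"
proof -
  interpret finite_measure "lebesgue_on \<Omega>"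
    using \<Omega>(1) by (rule finite_measure_lebesgue_on)
  have "mean_value \<Omega> g - mean_value \<Omega> h = (1 / measure lebesgue \<Omega>) * (LINT x|lebesgue_on \<Omega>. g x - h x)"
    using g h by (simp add: mean_value_def right_diff_distrib)
  moreover have "\<bar>LINT x|lebesgue_on \<Omega>. g x - h x\<bar> \<le> c * measure lebesgue \<Omega>"
    using abs_integral_le_const[of "\<lambda>x. g x - h x" c] g h le \<Omega>
    by (simp add: measure_restrict_space fmeasurableD space_restrict_space)
  ultimately show ?thesis
    using \<Omega>(2) by (simp add: abs_mult pos_divide_le_eq)
qed

lemma mean_value_bounds:
  assumes \<Omega>: "\<Omega> \<in> lmeasurable" "measure lebesgue \<Omega> > 0"
    and g: "integrable (lebesgue_on \<Omega>) g" and "\<And>x. c \<le> g x" "\<And>x. g x \<le> d"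
  shows "c \<le> mean_value \<Omega> g" "mean_value \<Omega> g \<le> d"
proof -
  interpret finite_measure "lebesgue_on \<Omega>"
    using \<Omega>(1) by (rule finite_measure_lebesgue_on)
  have "(LINT x|lebesgue_on \<Omega>. c) \<le> (LINT x|lebesgue_on \<Omega>. g x)"
    "(LINT x|lebesgue_on \<Omega>. g x) \<le> (LINT x|lebesgue_on \<Omega>. d)"
    using g assms(4,5) by (intro integral_mono integrable_const; simp)+
  then show "c \<le> mean_value \<Omega> g" "mean_value \<Omega> g \<le> d"
    using \<Omega> by (auto simp: mean_value_def measure_restrict_space fmeasurableD
        space_restrict_space field_simps)
qed

text \<open>\<open>V\<close> is nondecreasing and bounded, so its late increments over a window of
  length \<open>\<delta>\<close> are below \<open>\<delta> * (e / 2)\<close>. The mean value theorem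
  finds a point of the window with \<open>h\<close> below \<open>e / 2\<close>, and the Lipschitz
  bound carries this back to the start of the window at a cost of at most
  \<open>e / 2\<close>.\<close>

lemma Barbalat:
  fixes V h :: "real \<Rightarrow> real"
  assumes der: "\<And>t. t \<ge> 0 \<Longrightarrow> (V has_real_derivative h t) (at t within {0..})"
    and nonneg: "\<And>t. t \<ge> 0 \<Longrightarrow> h t \<ge> 0"
    and bdd: "\<And>t. t \<ge> 0 \<Longrightarrow> V t \<le> B"
    and lip: "\<And>s t. 0 \<le> s \<Longrightarrow> s \<le> t \<Longrightarrow> \<bar>h t - h s\<bar> \<le> C * (t - s)"
  shows "(h \<longlongrightarrow> 0) at_top"
proof (rule tendstoI)
  fix e :: real assume "e > 0"
  \<comment> \<open>\<open>D\<close> is a positive majorant of \<open>C\<close>, by which one may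
    divide; \<open>\<delta>\<close> is then short enough for \<open>h\<close> to vary by at most
    \<open>e / 2\<close> across the window.\<close>
  define D where "D = max C 1"
  define \<delta> where "\<delta> = e / (2 * D)"
  have D: "D > 0" "C \<le> D"
    by (auto simp: D_def)
  have \<delta>: "\<delta> > 0" "D * \<delta> = e / 2"
    using \<open>e > 0\<close> D by (auto simp: \<delta>_def)
  have mean: "\<exists>z. s < z \<and> z < t \<and> V t - V s = (t - s) * h z" if "0 \<le> s" "s < t" for s t
  proof -
    have "continuous_on {0..} V"
      using der by (intro DERIV_continuous_on) auto
    then have "continuous_on {s..t} V"
      by (rule continuous_on_subset) (use that in auto)
    moreover have "(V has_derivative (*) (h x)) (at x)" if "s < x" "x < t" for x
    proof -
      have "at x within {0..} = at x"
        using that \<open>0 \<le> s\<close> by (intro at_within_interior) auto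
      then show ?thesis
        using der[of x] that \<open>0 \<le> s\<close> by (simp add: has_field_derivative_def)
    qed
    ultimately obtain z where "s < z" "z < t" "V t - V s = h z * (t - s)"
      by (rule mvt[OF \<open>s < t\<close>])
    then show ?thesis
      by (auto simp: mult.commute)
  qed
  have mono: "V s \<le> V t" if "0 \<le> s" "s \<le> t" for s t
  proof (cases "s = t")
    case False
    then obtain z where "s < z" "V t - V s = (t - s) * h z"
      using mean[of s t] \<open>0 \<le> s\<close> \<open>s \<le> t\<close> by force
    then show ?thesis
      using nonneg[of z] that mult_nonneg_nonneg[of "t - s" "h z"] by linarith
  qed simp
  define S where "S = (SUP t\<in>{0..}. V t)"
  have bddV: "bdd_above (V ` {0..})"
    using bdd by (intro bdd_aboveI2[where M = B]) auto
  have "S - \<delta> * (e / 2) < S"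
    using \<delta> \<open>e > 0\<close> by simp
  then obtain T where T: "T \<ge> 0" "S - \<delta> * (e / 2) < V T"
    unfolding S_def by (subst (asm) less_cSUP_iff[OF _ bddV]) auto
  show "\<forall>\<^sub>F t in at_top. dist (h t) 0 < e"
    unfolding eventually_at_top_linorder
  proof (intro exI[of _ "T + 1"] allI impI)
    fix t assume t: "t \<ge> T + 1"
    obtain z where z: "t < z" "z < t + \<delta>" "V (t + \<delta>) - V t = \<delta> * h z"
      using mean[of t "t + \<delta>"] t T \<delta> by auto
    have "V (t + \<delta>) \<le> S"
      unfolding S_def using t T \<delta> by (intro cSUP_upper bddV) auto
    moreover have "V T \<le> V t"
      using mono t T by simp
    ultimately have "\<delta> * h z < \<delta> * (e / 2)"
      using z T by linarith
    then have "h z < e / 2"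
      using \<delta> by simp
    moreover have "h t - h z \<le> e / 2"
    proof -
      have "\<bar>h z - h t\<bar> \<le> C * (z - t)"
        using lip[of t z] z t T by simp
      also have "\<dots> \<le> D * (z - t)"
        using z D by (intro mult_right_mono) auto
      also have "\<dots> \<le> D * \<delta>"
        using z D by (intro mult_left_mono) auto
      finally show ?thesis
        using \<delta> by linarith
    qed
    ultimately show "dist (h t) 0 < e"
      using nonneg[of t] t T by (simp add: dist_real_def)
  qed
qed

text \<open>\<open>p\<close> and \<open>q\<close> stand for \<open>a n\<close> and
  \<open>b n\<close> at the index chosen for \<open>u\<^sub>0\<close>; \<open>f_pq\<close> turns
  them into barriers for the flow.\<close>

locale nonlocal_ode =
  fixes \<Omega> :: "'a::euclidean_space set" and f :: "real \<Rightarrow> real" and p q :: real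
    and u\<^sub>0 :: "'a \<Rightarrow> real"
  assumes \<Omega>: "\<Omega> \<in> lmeasurable" "measure lebesgue \<Omega> > 0"
    and f_lipschitz: "\<And>s. \<exists>r>0. \<exists>L. L-lipschitz_on (cball s r) f"
    and pq: "p \<le> q"
    and f_pq: "\<And>s. p \<le> s \<Longrightarrow> s \<le> q \<Longrightarrow> f q \<le> f s \<and> f s \<le> f p"
    and u0_Linf: "u\<^sub>0 \<in> Linf \<Omega>"
    and u0_pq: "AE x in lebesgue_on \<Omega>. p \<le> u\<^sub>0 x \<and> u\<^sub>0 x \<le> q"
begin

sublocale finite_measure "lebesgue_on \<Omega>"
  using \<Omega>(1) by (rule finite_measure_lebesgue_on)

section \<open>The truncated nonlinearity\<close>

definition clip :: "real \<Rightarrow> real" where "clip s = max p (min q s)"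

definition g :: "real \<Rightarrow> real" where "g s = f (clip s)"

lemma clip: "p \<le> clip s" "clip s \<le> q" "\<bar>clip s - clip t\<bar> \<le> \<bar>s - t\<bar>"
  using pq by (auto simp: clip_def)

lemma clip_id: "p \<le> s \<Longrightarrow> s \<le> q \<Longrightarrow> clip s = s"
  by (simp add: clip_def)

lemma g_eq: "p \<le> s \<Longrightarrow> s \<le> q \<Longrightarrow> g s = f s"
  by (simp add: g_def clip_id)

lemma g_bounds: "f q \<le> g s" "g s \<le> f p"
  using f_pq[of "clip s"] clip by (auto simp: g_def)

lemma f_continuous: "continuous_on UNIV f"
  using f_lipschitz by (rule continuous_on_if_locally_lipschitz)

text \<open>\<open>clip\<close> does not increase distances, so a Lipschitz constant of
  \<open>f\<close> between \<open>p\<close> and \<open>q\<close> serves \<open>g\<close> on the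
  whole line.\<close>

lemma g_lipschitz: "\<exists>L\<ge>0. \<forall>s t. \<bar>g s - g t\<bar> \<le> L * \<bar>s - t\<bar>"
proof -
  obtain L where L: "L-lipschitz_on {p..q} f"
    using lipschitz_on_Icc_if_locally[OF f_lipschitz] by blast
  have "\<bar>g s - g t\<bar> \<le> L * \<bar>s - t\<bar>" for s t
  proof -
    have "\<bar>g s - g t\<bar> \<le> L * \<bar>clip s - clip t\<bar>"
      using lipschitz_onD[OF L, of "clip s" "clip t"] clip by (simp add: g_def dist_real_def)
    also have "\<dots> \<le> L * \<bar>s - t\<bar>"
      using clip lipschitz_on_nonneg[OF L] by (intro mult_left_mono)
    finally show ?thesis .
  qed
  then show ?thesis
    using lipschitz_on_nonneg[OF L] by blast
qed

lemma g_continuous: "continuous_on S g"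
  unfolding g_def clip_def
  by (intro continuous_on_compose2[OF f_continuous] continuous_intros) auto

lemma u0_measurable [measurable]: "u\<^sub>0 \<in> borel_measurable (lebesgue_on \<Omega>)"
  using u0_Linf by (rule Linf_measurable)

lemma g_measurable [measurable]: "g \<in> borel_measurable borel"
  using g_continuous by (rule borel_measurable_continuous_onI)

lemma bcontfun_measurable [measurable]:
  fixes v :: "real \<Rightarrow>\<^sub>C real"
  shows "apply_bcontfun v \<in> borel_measurable borel"
  by (rule borel_measurable_continuous_onI) simp

text \<open>The values of \<open>g\<close> and their mean share the range from \<open>f q\<close> to
  \<open>f p\<close>, so its width bounds the speed of the flow.\<close>

definition K :: real where "K = f p - f q"

lemma K_nonneg: "K \<ge> 0"
  using g_bounds[of 0] by (simp add: K_def)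

lemma g_abs_le: "\<bar>g s\<bar> \<le> \<bar>f p\<bar> + \<bar>f q\<bar>"
  using g_bounds[of s] by linarith

lemma integrable_g: "h \<in> borel_measurable (lebesgue_on \<Omega>) \<Longrightarrow> integrable (lebesgue_on \<Omega>) (\<lambda>x. g (h x))"
  by (rule integrable_const_bound[where B = "\<bar>f p\<bar> + \<bar>f q\<bar>"]) (auto simp: g_abs_le)

text \<open>This functional is the only coupling between different initial values; the rest of
  \<open>field\<close> acts at each \<open>s\<close> separately.\<close>

definition avg :: "(real \<Rightarrow>\<^sub>C real) \<Rightarrow> real"
  where "avg v = mean_value \<Omega> (\<lambda>x. g (v (u\<^sub>0 x)))"

lemma avg_bounds: "f q \<le> avg v" "avg v \<le> f p"
  unfolding avg_def using g_bounds by (auto intro!: mean_value_bounds[OF \<Omega>] integrable_g)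

definition field :: "(real \<Rightarrow>\<^sub>C real) \<Rightarrow> (real \<Rightarrow>\<^sub>C real)"
  where "field v = Bcontfun (\<lambda>s. g (v s) - avg v)"

lemma g_avg_le: "\<bar>g s - avg v\<bar> \<le> K"
  using g_bounds[of s] avg_bounds[of v] by (simp add: K_def abs_le_iff)

lemma field_apply: "field v s = g (v s) - avg v"
proof -
  have "(\<lambda>s. g (v s) - avg v) \<in> bcontfun"
  proof (rule bcontfun_normI)
    show "continuous_on UNIV (\<lambda>s. g (v s) - avg v)"
      by (intro continuous_intros continuous_on_compose2[OF g_continuous[of UNIV]]) auto
    show "norm (g (v s) - avg v) \<le> K" for s
      using g_avg_le by simp
  qed
  then show ?thesis
    unfolding field_def by (subst Bcontfun_inverse) auto
qed

lemma field_le: "\<bar>field v s\<bar> \<le> K"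
  by (simp add: field_apply g_avg_le)

lemma field_norm_le: "norm (field v) \<le> K"
  using field_le by (intro norm_bound) simp

text \<open>One \<open>L\<close> comes from \<open>g\<close> and another from the mean; both changes
  are controlled by the supremum distance.\<close>

lemma field_lipschitz: "\<exists>L. L-lipschitz_on UNIV field"
proof -
  obtain L where L: "L \<ge> 0" "\<And>s t. \<bar>g s - g t\<bar> \<le> L * \<bar>s - t\<bar>"
    using g_lipschitz by blast
  have le: "\<bar>g (v s) - g (w s)\<bar> \<le> L * dist v w" for v w :: "real \<Rightarrow>\<^sub>C real" and s
  proof -
    have "\<bar>g (v s) - g (w s)\<bar> \<le> L * dist (v s) (w s)"
      using L(2) by (simp add: dist_real_def)
    also have "\<dots> \<le> L * dist v w"
      using L(1) dist_bounded by (intro mult_left_mono)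
    finally show ?thesis .
  qed
  have "(2 * L)-lipschitz_on UNIV field"
  proof (rule lipschitz_onI)
    fix v w :: "real \<Rightarrow>\<^sub>C real"
    have "\<bar>avg v - avg w\<bar> \<le> L * dist v w"
      unfolding avg_def using le by (intro mean_value_diff_le[OF \<Omega>] integrable_g) auto
    then have "dist (field v s) (field w s) \<le> 2 * L * dist v w" for s
      using le[of v s w] unfolding field_apply dist_real_def by linarith
    then show "dist (field v) (field w) \<le> 2 * L * dist v w"
      by (rule dist_bound)
  qed (use L in simp)
  then show ?thesis
    by blast
qed

text \<open>The initial datum is \<open>clip\<close> rather than the identity because it must be
  bounded; it leaves \<open>u\<^sub>0 x\<close> unchanged for almost every \<open>x\<close>. The
  constant continuation to negative times makes the orbit a map on all of \<open>real\<close>, as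
  \<open>orbit_limit_set\<close> expects.\<close>

lemma flow_exists:
  "\<exists>y. (\<forall>s. apply_bcontfun (y 0) s = clip s) \<and> (\<forall>t\<le>0. y t = y 0) \<and>
    (\<forall>t\<ge>0. (y has_vector_derivative field (y t)) (at t within {0..}))"
proof -
  obtain L where L: "L-lipschitz_on UNIV field"
    using field_lipschitz by blast
  obtain y where y: "y 0 = Bcontfun clip"
      "\<And>t. t \<ge> 0 \<Longrightarrow> (y has_vector_derivative field (y t)) (at t within {0..})"
    using lipschitz_ode_global_solution[OF L] by blast
  have "clip \<in> bcontfun"
    by (rule bcontfun_normI[where b = "\<bar>p\<bar> + \<bar>q\<bar>"])
      (auto simp: clip_def[abs_def] intro!: continuous_intros)
  then have "apply_bcontfun (y 0) s = clip s" for s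
    by (simp add: y(1) Bcontfun_inverse)
  moreover have "((\<lambda>t. y (max 0 t)) has_vector_derivative field (y t)) (at t within {0..})" if "t \<ge> 0" for t
    by (rule has_vector_derivative_transform[OF _ _ y(2)]) (use that in auto)
  ultimately show ?thesis
    by (intro exI[of _ "\<lambda>t. y (max 0 t)"]) auto
qed

section \<open>The flow: barriers, monotonicity and regularity in time\<close>

definition flow :: "real \<Rightarrow> (real \<Rightarrow>\<^sub>C real)" where
  "flow = (SOME y. (\<forall>s. apply_bcontfun (y 0) s = clip s) \<and> (\<forall>t\<le>0. y t = y 0) \<and>
    (\<forall>t\<ge>0. (y has_vector_derivative field (y t)) (at t within {0..})))"

lemma flow_properties:
  "(\<forall>s. flow 0 s = clip s) \<and> (\<forall>t\<le>0. flow t = flow 0) \<and>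
    (\<forall>t\<ge>0. (flow has_vector_derivative field (flow t)) (at t within {0..}))"
  unfolding flow_def by (rule someI_ex[OF flow_exists])

lemma flow_0: "flow 0 s = clip s"
  and flow_neg: "t \<le> 0 \<Longrightarrow> flow t = flow 0"
  and flow_deriv: "t \<ge> 0 \<Longrightarrow> (flow has_vector_derivative field (flow t)) (at t within {0..})"
  using flow_properties by blast+

lemma flow_max: "flow t = flow (max 0 t)"
  using flow_neg[of t] by (cases "t \<ge> 0") auto

lemma flow_deriv_apply:
  assumes "t \<ge> 0"
  shows "((\<lambda>t. flow t s) has_real_derivative g (flow t s) - avg (flow t)) (at t within {0..})"
proof -
  have "bounded_linear (\<lambda>v :: real \<Rightarrow>\<^sub>C real. v s)"
    by (rule bounded_linear_intro[where K = 1])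
      (use norm_bounded[where 'b = real] in auto)
  from bounded_linear.has_vector_derivative[OF this flow_deriv[OF assms]] show ?thesis
    by (simp add: has_real_derivative_iff_has_vector_derivative field_apply)
qed

text \<open>Below \<open>p\<close> the truncation freezes \<open>g\<close> at \<open>f p\<close>,
  which is at least the mean, so a trajectory there cannot decrease; above \<open>q\<close> it is
  frozen at \<open>f q\<close>, at most the mean. Hence comparison works with
  \<open>L = 0\<close>.\<close>

lemma flow_bounds: "p \<le> flow t s" "flow t s \<le> q"
proof -
  have "p \<le> flow t s \<and> flow t s \<le> q" if "t \<ge> 0" for t
  proof
    have "0 \<le> flow t s - p"
    proof (rule nonneg_if_derivative_ge[where L = 0, OF _ _ _ that])
      show "((\<lambda>t. flow t s - p) has_real_derivative g (flow t s) - avg (flow t)) (at t within {0..})"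
        if "t \<ge> 0" for t
        using flow_deriv_apply[OF that, of s] by (auto intro!: derivative_eq_intros)
      show "0 \<le> flow 0 s - p"
        using clip by (simp add: flow_0)
      show "0 * (flow t s - p) \<le> g (flow t s) - avg (flow t)" if "flow t s - p < 0" for t
        using that avg_bounds[of "flow t"] pq by (simp add: g_def clip_def)
    qed
    then show "p \<le> flow t s"
      by simp
    have "0 \<le> q - flow t s"
    proof (rule nonneg_if_derivative_ge[where L = 0, OF _ _ _ that])
      show "((\<lambda>t. q - flow t s) has_real_derivative - (g (flow t s) - avg (flow t))) (at t within {0..})"
        if "t \<ge> 0" for t
        using flow_deriv_apply[OF that, of s] by (auto intro!: derivative_eq_intros)
      show "0 \<le> q - flow 0 s"
        using clip by (simp add: flow_0)
      show "0 * (q - flow t s) \<le> - (g (flow t s) - avg (flow t))" if "q - flow t s < 0" for t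
        using that avg_bounds[of "flow t"] pq by (simp add: g_def clip_def)
    qed
    then show "flow t s \<le> q"
      by simp
  qed
  from this[of "max 0 t"] show "p \<le> flow t s" "flow t s \<le> q"
    using flow_max[of t] by auto
qed

text \<open>In the difference of two trajectories the common mean cancels, leaving a scalar
  comparison with the Lipschitz constant of \<open>g\<close>. Monotonicity in the initial value is
  what makes Helly's theorem available.\<close>

lemma flow_mono: "mono (flow t)"
proof (rule monoI)
  fix s1 s2 :: real assume "s1 \<le> s2"
  obtain L where L: "L \<ge> 0" "\<And>s t. \<bar>g s - g t\<bar> \<le> L * \<bar>s - t\<bar>"
    using g_lipschitz by blast
  have "0 \<le> flow t s2 - flow t s1" if "t \<ge> 0" for t
  proof (rule nonneg_if_derivative_ge[where L = L, OF _ _ _ that])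
    show "((\<lambda>t. flow t s2 - flow t s1) has_real_derivative g (flow t s2) - g (flow t s1))
        (at t within {0..})" if "t \<ge> 0" for t
      using flow_deriv_apply[OF that, of s1] flow_deriv_apply[OF that, of s2]
      by (auto intro!: derivative_eq_intros)
    show "0 \<le> flow 0 s2 - flow 0 s1"
      using \<open>s1 \<le> s2\<close> by (auto simp: flow_0 clip_def)
    show "L * (flow t s2 - flow t s1) \<le> g (flow t s2) - g (flow t s1)"
      if "flow t s2 - flow t s1 < 0" for t
      using L(2)[of "flow t s2" "flow t s1"] that by (simp add: abs_if right_diff_distrib split: if_splits)
  qed
  from this[of "max 0 t"] show "flow t s1 \<le> flow t s2"
    using flow_max[of t] by simp
qed

lemma flow_lipschitz: "norm (flow t - flow s) \<le> K * \<bar>t - s\<bar>"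
proof -
  have "norm (flow t - flow s) \<le> K * norm (t - s)" if "t \<ge> 0" "s \<ge> 0" for t s
  proof (rule differentiable_bound[where S = "{0..}"])
    show "(flow has_derivative (\<lambda>h. h *\<^sub>R field (flow r))) (at r within {0..})" if "r \<in> {0..}" for r
      using flow_deriv that by (simp add: has_vector_derivative_def)
    show "onorm (\<lambda>h. h *\<^sub>R field (flow r)) \<le> K" for r
      using field_norm_le[of "flow r"] by (intro onorm_le) (simp add: mult.commute[of K] mult_left_mono)
  qed (use that in auto)
  from this[of "max 0 t" "max 0 s"] have "norm (flow t - flow s) \<le> K * \<bar>max 0 t - max 0 s\<bar>"
    using flow_max[of t] flow_max[of s] by simp
  also have "\<dots> \<le> K * \<bar>t - s\<bar>"
    using K_nonneg by (intro mult_left_mono) auto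
  finally show ?thesis .
qed

section \<open>The solution carried by the flow\<close>

definition u :: "real \<Rightarrow> 'a \<Rightarrow> real" where "u t x = flow t (u\<^sub>0 x)"

definition u' :: "real \<Rightarrow> 'a \<Rightarrow> real" where "u' t x = field (flow t) (u\<^sub>0 x)"

lemma u_measurable [measurable]:
  "u t \<in> borel_measurable (lebesgue_on \<Omega>)" "u' t \<in> borel_measurable (lebesgue_on \<Omega>)"
  unfolding u_def[abs_def] u'_def[abs_def] by measurable

lemma u_abs_le: "\<bar>u t x\<bar> \<le> \<bar>p\<bar> + \<bar>q\<bar>"
  using flow_bounds[of t "u\<^sub>0 x"] unfolding u_def by linarith

lemma u_integrable: "integrable (lebesgue_on \<Omega>) (u t)"
  by (rule integrable_const_bound[where B = "\<bar>p\<bar> + \<bar>q\<bar>"]) (auto simp: u_abs_le)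

text \<open>Evaluation at \<open>u\<^sub>0 x\<close> is bounded by the supremum norm uniformly in
  \<open>x\<close>. Differentiability of \<open>flow\<close> and continuity of
  \<open>field (flow t)\<close> in that norm therefore pass to the norm of L-infinity.\<close>

lemma u_C1: "C1_Linf \<Omega> {0..} u u'"
  unfolding C1_Linf_def
proof (intro conjI ballI)
  fix t :: real assume t: "t \<in> {0..}"
  show "u t \<in> Linf \<Omega>" "u' t \<in> Linf \<Omega>"
    using u_abs_le field_le by (auto simp: u'_def intro!: LinfI[OF u_measurable(1) AE_I2]
        LinfI[OF u_measurable(2) AE_I2])
  show "((\<lambda>s. Linf_norm \<Omega> (\<lambda>x. (u s x - u t x) / (s - t) - u' t x)) \<longlongrightarrow> 0) (at t within {0..})"
  proof (rule Linf_norm_tendsto_0[OF \<Omega>(2)])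
    let ?b = "\<lambda>s. ((flow s - flow t) - (s - t) *\<^sub>R field (flow t)) /\<^sub>R norm (s - t)"
    have "(?b \<longlongrightarrow> 0) (at t within {0..})"
      using flow_deriv t unfolding has_vector_derivative_def has_derivative_at_within by simp
    then show "((\<lambda>s. norm (?b s)) \<longlongrightarrow> 0) (at t within {0..})"
      by (rule tendsto_norm_zero)
    have "\<forall>\<^sub>F s in at t within {0..}. s \<noteq> t"
      by (simp add: eventually_at_filter)
    then show "\<forall>\<^sub>F s in at t within {0..}. \<forall>x. \<bar>(u s x - u t x) / (s - t) - u' t x\<bar> \<le> norm (?b s)"
    proof eventually_elim
      fix s assume "s \<noteq> t"
      show "\<forall>x. \<bar>(u s x - u t x) / (s - t) - u' t x\<bar> \<le> norm (?b s)"
      proof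
        fix x
        have "\<bar>(u s x - u t x) / (s - t) - u' t x\<bar> = \<bar>((u s x - u t x) - (s - t) * u' t x) / (s - t)\<bar>"
          using \<open>s \<noteq> t\<close> by (simp add: diff_divide_distrib)
        also have "\<dots> = norm (apply_bcontfun (?b s) (u\<^sub>0 x))"
          by (simp add: u_def u'_def abs_mult divide_inverse mult.commute)
        also have "\<dots> \<le> norm (?b s)"
          by (rule norm_bounded)
        finally show "\<bar>(u s x - u t x) / (s - t) - u' t x\<bar> \<le> norm (?b s)" .
      qed
    qed
  qed measurable
  show "((\<lambda>s. Linf_norm \<Omega> (\<lambda>x. u' s x - u' t x)) \<longlongrightarrow> 0) (at t within {0..})"
  proof (rule Linf_norm_tendsto_0[OF \<Omega>(2)])
    have "continuous_on UNIV field"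
      using field_lipschitz lipschitz_on_continuous_on by blast
    moreover have "(flow \<longlongrightarrow> flow t) (at t within {0..})"
      using has_vector_derivative_continuous[OF flow_deriv] t by (auto simp: continuous_within)
    ultimately have "((\<lambda>s. field (flow s)) \<longlongrightarrow> field (flow t)) (at t within {0..})"
      by (intro isCont_tendsto_compose[of _ field]) (auto simp: continuous_on_eq_continuous_at)
    then have "((\<lambda>s. field (flow s) - field (flow t)) \<longlongrightarrow> 0) (at t within {0..})"
      by (simp add: LIM_zero)
    then show "((\<lambda>s. norm (field (flow s) - field (flow t))) \<longlongrightarrow> 0) (at t within {0..})"
      by (rule tendsto_norm_zero)
    have "\<bar>u' s x - u' t x\<bar> \<le> norm (field (flow s) - field (flow t))" for s x
      using norm_bounded[of "field (flow s) - field (flow t)" "u\<^sub>0 x"] by (simp add: u'_def)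
    then show "\<forall>\<^sub>F s in at t within {0..}. \<forall>x. \<bar>u' s x - u' t x\<bar> \<le> norm (field (flow s) - field (flow t))"
      by simp
  qed measurable
qed

text \<open>The flow never leaves the interval on which \<open>g\<close> and \<open>f\<close> agree,
  so the truncation disappears from the equation.\<close>

lemma u_eq: "u' t x = f (u t x) - mean_value \<Omega> (\<lambda>y. f (u t y))"
  by (simp add: u'_def field_apply avg_def g_eq flow_bounds u_def)

lemma u_solution: "global_solution \<Omega> f u\<^sub>0 u"
  unfolding solution_on_def
proof (intro conjI exI[of _ u'])
  show "AE x in lebesgue_on \<Omega>. u 0 x = u\<^sub>0 x"
    using u0_pq by eventually_elim (simp add: u_def flow_0 clip_id)
qed (auto simp: u_C1 u_eq)

lemma u_unique:
  assumes "global_solution \<Omega> f u\<^sub>0 v" and "t \<ge> 0"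
  shows "AE x in lebesgue_on \<Omega>. v t x = u t x"
  using solution_unique[OF \<Omega> f_lipschitz u0_Linf u_solution] assms by blast

section \<open>Decay of the dissipation\<close>

text \<open>This is the time derivative of the integral of \<open>F (u t x)\<close> for any
  antiderivative \<open>F\<close> of \<open>g\<close>.\<close>

definition dissipation :: "real \<Rightarrow> real" where
  "dissipation t = (LINT x|lebesgue_on \<Omega>. (u' t x)\<^sup>2)"

text \<open>The difference of squares factors into a sum bounded by \<open>2 * K\<close> and a
  difference with Lipschitz constant \<open>L * K\<close>, where \<open>L\<close> comes from
  \<open>field\<close> and \<open>K\<close> from \<open>flow\<close>. This is the regularity that
  \<open>Barbalat\<close> asks for.\<close>

lemma dissipation_lipschitz: "\<exists>C. \<forall>s t. \<bar>dissipation t - dissipation s\<bar> \<le> C * \<bar>t - s\<bar>"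
proof -
  obtain L where L: "L-lipschitz_on UNIV field"
    using field_lipschitz by blast
  have sq_int: "integrable (lebesgue_on \<Omega>) (\<lambda>x. (u' t x)\<^sup>2)" for t
    by (rule integrable_const_bound[where B = "K\<^sup>2"])
      (use field_le in \<open>auto simp: u'_def abs_le_square_iff[symmetric] K_nonneg intro!: AE_I2\<close>)
  have "\<bar>dissipation t - dissipation s\<bar> \<le> (2 * K * (L * K) * measure lebesgue \<Omega>) * \<bar>t - s\<bar>" for s t
  proof -
    have le: "\<bar>(u' t x)\<^sup>2 - (u' s x)\<^sup>2\<bar> \<le> 2 * K * (L * (K * \<bar>t - s\<bar>))" for x
    proof -
      have "\<bar>u' t x - u' s x\<bar> \<le> norm (field (flow t) - field (flow s))"
        using norm_bounded[of "field (flow t) - field (flow s)" "u\<^sub>0 x"] by (simp add: u'_def)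
      also have "\<dots> \<le> L * norm (flow t - flow s)"
        using lipschitz_onD[OF L] by (simp add: dist_norm)
      also have "\<dots> \<le> L * (K * \<bar>t - s\<bar>)"
        using flow_lipschitz lipschitz_on_nonneg[OF L] by (intro mult_left_mono)
      finally have "\<bar>u' t x - u' s x\<bar> \<le> L * (K * \<bar>t - s\<bar>)" .
      moreover have "\<bar>u' t x + u' s x\<bar> \<le> 2 * K"
        using field_le[of "flow t" "u\<^sub>0 x"] field_le[of "flow s" "u\<^sub>0 x"] unfolding u'_def by linarith
      ultimately have "\<bar>u' t x + u' s x\<bar> * \<bar>u' t x - u' s x\<bar> \<le> 2 * K * (L * (K * \<bar>t - s\<bar>))"
        using K_nonneg by (intro mult_mono) auto
      then show ?thesis
        by (simp add: abs_mult[symmetric] power2_eq_square algebra_simps)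
    qed
    have "dissipation t - dissipation s = (LINT x|lebesgue_on \<Omega>. (u' t x)\<^sup>2 - (u' s x)\<^sup>2)"
      unfolding dissipation_def using sq_int by simp
    moreover have "\<bar>LINT x|lebesgue_on \<Omega>. (u' t x)\<^sup>2 - (u' s x)\<^sup>2\<bar>
        \<le> 2 * K * (L * (K * \<bar>t - s\<bar>)) * measure lebesgue \<Omega>"
      using abs_integral_le_const[OF _ le] \<Omega>
      by (simp add: measure_restrict_space fmeasurableD space_restrict_space)
    ultimately show ?thesis
      by (simp add: algebra_simps)
  qed
  then show ?thesis
    by blast
qed

text \<open>\<open>Barbalat\<close> applies to the integral of \<open>F (u t x)\<close>: this is
  bounded because \<open>u\<close> stays between \<open>p\<close> and \<open>q\<close>, and its
  derivative is an integral of a square.\<close>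

lemma dissipation_tendsto_0: "(dissipation \<longlongrightarrow> 0) at_top"
proof -
  obtain F where F: "\<And>z. (F has_real_derivative g z) (at z)"
    using antiderivative_UNIV[OF g_continuous] by blast
  have Fcont: "continuous_on UNIV F"
    using F by (intro DERIV_continuous_on) (auto intro: has_field_derivative_at_within)
  have [measurable]: "F \<in> borel_measurable borel"
    using Fcont by (rule borel_measurable_continuous_onI)
  obtain B where B: "\<And>z. \<bar>z\<bar> \<le> \<bar>p\<bar> + \<bar>q\<bar> \<Longrightarrow> \<bar>F z\<bar> \<le> B"
    using continuous_bounded_on_abs_le[OF Fcont] by blast
  obtain C where C: "\<And>s t. \<bar>dissipation t - dissipation s\<bar> \<le> C * \<bar>t - s\<bar>"
    using dissipation_lipschitz by blast
  show ?thesis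
  proof (rule Barbalat)
    fix t :: real assume "t \<ge> 0"
    have "((\<lambda>s. LINT x|lebesgue_on \<Omega>. F (u s x)) has_real_derivative
        (LINT x|lebesgue_on \<Omega>. g (u t x) * u' t x)) (at t within {0..})"
    proof (rule has_real_derivative_integral_comp[where R = "\<bar>p\<bar> + \<bar>q\<bar>" and K = K])
      show "\<forall>\<^sub>F s in at t within {0..}.
          AE x in lebesgue_on \<Omega>. \<bar>(u s x - u t x) / (s - t) - u' t x\<bar> \<le> e" if "e > 0" for e
        using u_C1 \<open>t \<ge> 0\<close> that by (intro eventually_AE_abs_le) (auto simp: C1_Linf_def)
    qed (use \<open>t \<ge> 0\<close> F g_continuous u_abs_le field_le in \<open>auto simp: u'_def finite_measure_axioms\<close>)
    \<comment> \<open>Writing \<open>g (u t x) = u' t x + avg (flow t)\<close> isolates the square;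
      the mean then drops out because \<open>u' t\<close> has integral 0.\<close>
    also have "(LINT x|lebesgue_on \<Omega>. g (u t x) * u' t x)
        = (LINT x|lebesgue_on \<Omega>. (u' t x)\<^sup>2 + avg (flow t) * u' t x)"
      by (intro Bochner_Integration.integral_cong refl)
        (simp add: u_def u'_def field_apply power2_eq_square algebra_simps)
    also have "\<dots> = dissipation t + avg (flow t) * (LINT x|lebesgue_on \<Omega>. u' t x)"
    proof -
      have "integrable (lebesgue_on \<Omega>) (u' t)"
        by (rule integrable_const_bound[where B = K]) (auto simp: u'_def field_le)
      moreover have "integrable (lebesgue_on \<Omega>) (\<lambda>x. (u' t x)\<^sup>2)"
        by (rule integrable_const_bound[where B = "K\<^sup>2"])
          (use field_le in \<open>auto simp: u'_def abs_le_square_iff[symmetric] K_nonneg intro!: AE_I2\<close>)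
      ultimately show ?thesis
        by (simp add: dissipation_def)
    qed
    also have "(LINT x|lebesgue_on \<Omega>. u' t x) = 0"
      unfolding u'_def field_apply avg_def
      by (rule integral_minus_mean_value[OF \<Omega> integrable_g]) measurable
    finally show "((\<lambda>s. LINT x|lebesgue_on \<Omega>. F (u s x)) has_real_derivative dissipation t)
        (at t within {0..})"
      by simp
    show "dissipation t \<ge> 0"
      by (simp add: dissipation_def)
    have "\<bar>LINT x|lebesgue_on \<Omega>. F (u t x)\<bar> \<le> B * measure (lebesgue_on \<Omega>) (space (lebesgue_on \<Omega>))"
      using B u_abs_le by (intro abs_integral_le_const) auto
    then show "(LINT x|lebesgue_on \<Omega>. F (u t x)) \<le> B * measure (lebesgue_on \<Omega>) (space (lebesgue_on \<Omega>))"
      by simp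
  next
    show "\<bar>dissipation t - dissipation s\<bar> \<le> C * (t - s)" if "0 \<le> s" "s \<le> t" for s t
      using C[of t s] that by simp
  qed
qed

section \<open>The omega-limit set\<close>

sublocale L1: Metric_space "L1 \<Omega>" "L1_dist \<Omega>"
  by (rule Metric_space_L1)

abbreviation U :: "real \<Rightarrow> ('a \<Rightarrow> real) set" where "U t \<equiv> ae_class \<Omega> (u t)"

lemma U_L1: "U t \<in> L1 \<Omega>"
  using u_integrable by (auto simp: L1_def)

lemma U_continuous: "continuous_map euclideanreal L1.mtopology U"
proof -
  have dist: "L1_dist \<Omega> (U t) (U s) \<le> K * measure lebesgue \<Omega> * \<bar>t - s\<bar>" for s t
  proof -
    have le: "\<bar>\<bar>u t x - u s x\<bar>\<bar> \<le> K * \<bar>t - s\<bar>" for x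
      using norm_bounded[of "flow t - flow s" "u\<^sub>0 x"] flow_lipschitz[of t s] by (simp add: u_def)
    have "L1_dist \<Omega> (U t) (U s) = (LINT x|lebesgue_on \<Omega>. \<bar>u t x - u s x\<bar>)"
      by (simp add: L1_dist_ae_class)
    also have "\<dots> \<le> K * \<bar>t - s\<bar> * measure lebesgue \<Omega>"
      using abs_integral_le_const[OF _ le] \<Omega>
      by (simp add: measure_restrict_space fmeasurableD space_restrict_space)
    finally show ?thesis
      by (simp add: algebra_simps)
  qed
  \<comment> \<open>The added 1 makes \<open>D\<close> positive even when \<open>K = 0\<close>, so
    \<open>e / D\<close> is a legitimate radius.\<close>
  define D where "D = K * measure lebesgue \<Omega> + 1"
  have D: "D > 0" "K * measure lebesgue \<Omega> \<le> D"
    using K_nonneg by (auto simp: D_def add_nonneg_pos)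
  show ?thesis
    unfolding L1.continuous_map_to_metric
  proof (intro ballI allI impI)
    fix t e :: real assume "e > 0"
    show "\<exists>V. openin euclideanreal V \<and> t \<in> V \<and> (\<forall>s\<in>V. U s \<in> L1.mball (U t) e)"
    proof (intro exI[of _ "ball t (e / D)"] conjI ballI)
      fix s assume "s \<in> ball t (e / D)"
      then have "\<bar>t - s\<bar> * D < e"
        using D by (simp add: dist_real_def pos_less_divide_eq)
      moreover have "K * measure lebesgue \<Omega> * \<bar>t - s\<bar> \<le> D * \<bar>t - s\<bar>"
        using D by (intro mult_right_mono) auto
      ultimately have "L1_dist \<Omega> (U t) (U s) < e"
        using dist[of t s] by (simp add: mult.commute)
      then show "U s \<in> L1.mball (U t) e"
        by (simp add: U_L1)
    qed (use \<open>e > 0\<close> D in auto)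
  qed
qed

lemma pointwise_subsequence:
  obtains r F where "strict_mono (r :: nat \<Rightarrow> nat)" and "\<And>s. (\<lambda>k. flow (t (r k)) s) \<longlonglongrightarrow> F s"
proof (rule Helly_selection_pointwise[where g = "\<lambda>k. flow (t k)" and M = "\<bar>p\<bar> + \<bar>q\<bar>"])
  show "\<bar>flow (t k) s\<bar> \<le> \<bar>p\<bar> + \<bar>q\<bar>" for k s
    using flow_bounds[of "t k" s] by linarith
qed (use flow_mono that in auto)

section \<open>Pointwise limits of the flow along a sequence of times\<close>

context
  fixes t :: "nat \<Rightarrow> real" and F :: "real \<Rightarrow> real"
  assumes lim: "\<And>s. (\<lambda>k. flow (t k) s) \<longlonglongrightarrow> F s"
begin

lemma limit_bounds: "p \<le> F s" "F s \<le> q"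
  by (rule LIMSEQ_le_const[OF lim] LIMSEQ_le_const2[OF lim]; use flow_bounds in blast)+

lemma limit_measurable [measurable]: "F \<in> borel_measurable borel"
  by (rule borel_measurable_LIMSEQ_real[where u = "\<lambda>k. flow (t k)"]) (use lim in auto)

text \<open>Dominated convergence: the orbit and its limit both take values between \<open>p\<close>
  and \<open>q\<close>, so their distance is at most \<open>q - p\<close>.\<close>

lemma limit_L1: "limitin L1.mtopology (\<lambda>k. U (t k)) (ae_class \<Omega> (\<lambda>x. F (u\<^sub>0 x))) sequentially"
proof -
  have "\<bar>F s\<bar> \<le> \<bar>p\<bar> + \<bar>q\<bar>" for s
    using limit_bounds[of s] by linarith
  then have int: "integrable (lebesgue_on \<Omega>) (\<lambda>x. F (u\<^sub>0 x))"
    by (intro integrable_const_bound[where B = "\<bar>p\<bar> + \<bar>q\<bar>"]) auto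
  have le: "\<bar>u (t k) x - F (u\<^sub>0 x)\<bar> \<le> q - p" for k x
    using flow_bounds[of "t k" "u\<^sub>0 x"] limit_bounds[of "u\<^sub>0 x"] unfolding u_def by linarith
  have "(\<lambda>k. LINT x|lebesgue_on \<Omega>. \<bar>u (t k) x - F (u\<^sub>0 x)\<bar>) \<longlonglongrightarrow> (LINT x|lebesgue_on \<Omega>. 0)"
  proof (rule integral_dominated_convergence[where w = "\<lambda>_. q - p"])
    show "AE x in lebesgue_on \<Omega>. (\<lambda>k. \<bar>u (t k) x - F (u\<^sub>0 x)\<bar>) \<longlonglongrightarrow> 0"
      using lim by (auto simp: u_def intro!: AE_I2 tendsto_rabs_zero LIM_zero)
    show "AE x in lebesgue_on \<Omega>. norm \<bar>u (t k) x - F (u\<^sub>0 x)\<bar> \<le> q - p" for k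
      by (simp add: le)
  qed auto
  moreover have "L1_dist \<Omega> (U (t k)) (ae_class \<Omega> (\<lambda>x. F (u\<^sub>0 x)))
      = (LINT x|lebesgue_on \<Omega>. \<bar>u (t k) x - F (u\<^sub>0 x)\<bar>)" for k
    by (rule L1_dist_ae_class) auto
  ultimately show ?thesis
    unfolding L1.limitin_metric_dist_null using int U_L1 by (auto simp: L1_def)
qed

text \<open>Dominated convergence passes to the limit first in the mean and then in
  \<open>dissipation\<close>. The limiting dissipation is 0, so the square under the integral
  vanishes almost everywhere; as \<open>F\<close> stays between \<open>p\<close> and
  \<open>q\<close>, there \<open>g\<close> is \<open>f\<close>.\<close>

lemma limit_stationary:
  assumes t: "filterlim t at_top sequentially"
  shows "AE x in lebesgue_on \<Omega>. f (F (u\<^sub>0 x)) - mean_value \<Omega> (\<lambda>y. f (F (u\<^sub>0 y))) = 0"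
proof -
  let ?m = "mean_value \<Omega> (\<lambda>x. g (F (u\<^sub>0 x)))"
  have g_lim: "(\<lambda>k. g (flow (t k) s)) \<longlonglongrightarrow> g (F s)" for s
    using g_continuous[of UNIV] lim
    by (intro isCont_tendsto_compose[of _ g]) (auto simp: continuous_on_eq_continuous_at)
  have "(\<lambda>k. LINT x|lebesgue_on \<Omega>. g (flow (t k) (u\<^sub>0 x))) \<longlonglongrightarrow> (LINT x|lebesgue_on \<Omega>. g (F (u\<^sub>0 x)))"
  proof (rule integral_dominated_convergence[where w = "\<lambda>_. \<bar>f p\<bar> + \<bar>f q\<bar>"])
    show "AE x in lebesgue_on \<Omega>. norm (g (flow (t k) (u\<^sub>0 x))) \<le> \<bar>f p\<bar> + \<bar>f q\<bar>" for k
      by (simp add: g_abs_le)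
  qed (use g_lim in auto)
  then have avg_lim: "(\<lambda>k. avg (flow (t k))) \<longlonglongrightarrow> ?m"
    unfolding avg_def mean_value_def by (intro tendsto_intros)
  have u'_lim: "(\<lambda>k. u' (t k) x) \<longlonglongrightarrow> g (F (u\<^sub>0 x)) - ?m" for x
    unfolding u'_def field_apply by (intro tendsto_diff g_lim avg_lim)
  have le: "\<bar>g (F (u\<^sub>0 x)) - ?m\<bar> \<le> K" for x
    by (rule LIMSEQ_le_const2[OF tendsto_rabs[OF u'_lim]]) (use field_le in \<open>auto simp: u'_def\<close>)
  have "(\<lambda>k. dissipation (t k)) \<longlonglongrightarrow> (LINT x|lebesgue_on \<Omega>. (g (F (u\<^sub>0 x)) - ?m)\<^sup>2)"
    unfolding dissipation_def
  proof (rule integral_dominated_convergence[where w = "\<lambda>_. K\<^sup>2"])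
    show "AE x in lebesgue_on \<Omega>. (\<lambda>k. (u' (t k) x)\<^sup>2) \<longlonglongrightarrow> (g (F (u\<^sub>0 x)) - ?m)\<^sup>2"
      using u'_lim by (auto intro!: tendsto_intros)
    show "AE x in lebesgue_on \<Omega>. norm ((u' (t k) x)\<^sup>2) \<le> K\<^sup>2" for k
      using field_le by (auto simp: u'_def abs_le_square_iff[symmetric] K_nonneg intro!: AE_I2)
  qed auto
  moreover have "(\<lambda>k. dissipation (t k)) \<longlonglongrightarrow> 0"
    using dissipation_tendsto_0 t by (rule filterlim_compose)
  ultimately have "(LINT x|lebesgue_on \<Omega>. (g (F (u\<^sub>0 x)) - ?m)\<^sup>2) = 0"
    using LIMSEQ_unique by blast
  moreover have "integrable (lebesgue_on \<Omega>) (\<lambda>x. (g (F (u\<^sub>0 x)) - ?m)\<^sup>2)"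
    by (rule integrable_const_bound[where B = "K\<^sup>2"])
      (use le in \<open>auto simp: abs_le_square_iff[symmetric] K_nonneg intro!: AE_I2\<close>)
  ultimately have "AE x in lebesgue_on \<Omega>. (g (F (u\<^sub>0 x)) - ?m)\<^sup>2 = 0"
    by (subst (asm) integral_nonneg_eq_0_iff_AE) auto
  then show ?thesis
    by eventually_elim (simp add: g_eq limit_bounds)
qed

end

text \<open>Uniqueness replaces an arbitrary global solution by the constructed \<open>u\<close>.
  The two agree only at nonnegative times, which is enough because \<open>t k\<close> is eventually
  nonnegative.\<close>

lemma omega_limit_eq:
  "omega_limit \<Omega> f u\<^sub>0 = {\<Phi>. \<exists>t. filterlim t at_top sequentially \<and>
    limitin L1.mtopology (\<lambda>k::nat. U (t k)) \<Phi> sequentially}"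
proof (intro equalityI subsetI)
  fix \<Phi> assume "\<Phi> \<in> omega_limit \<Omega> f u\<^sub>0"
  then obtain v t where v: "global_solution \<Omega> f u\<^sub>0 v" and t: "filterlim t at_top sequentially"
    and lim: "limitin L1.mtopology (\<lambda>k::nat. ae_class \<Omega> (v (t k))) \<Phi> sequentially"
    by (auto simp: omega_limit_def L1_topology_def)
  have "\<forall>\<^sub>F k in sequentially. t k \<ge> 0"
    using t by (simp add: filterlim_at_top)
  then have "\<forall>\<^sub>F k in sequentially. ae_class \<Omega> (v (t k)) = U (t k)"
  proof eventually_elim
    fix k assume k: "t k \<ge> 0"
    have "v (t k) \<in> borel_measurable (lebesgue_on \<Omega>)"
      using v k by (auto simp: solution_on_def C1_Linf_def Linf_def)
    then show "ae_class \<Omega> (v (t k)) = U (t k)"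
      using u_unique[OF v k] by (simp add: ae_class_eq_iff)
  qed
  from limitin_transform_eventually[OF this lim]
  show "\<Phi> \<in> {\<Phi>. \<exists>t. filterlim t at_top sequentially \<and>
      limitin L1.mtopology (\<lambda>k::nat. U (t k)) \<Phi> sequentially}"
    using t by blast
next
  fix \<Phi> assume "\<Phi> \<in> {\<Phi>. \<exists>t. filterlim t at_top sequentially \<and>
      limitin L1.mtopology (\<lambda>k::nat. U (t k)) \<Phi> sequentially}"
  then show "\<Phi> \<in> omega_limit \<Omega> f u\<^sub>0"
    using u_solution L1.limitin_mspace by (auto simp: omega_limit_def L1_topology_def)
qed

text \<open>Helly selection followed by \<open>limit_L1\<close> supplies the precompactness that
  \<open>orbit_limit_set\<close> requires.\<close>

lemma omega_limit_topology:
  "omega_limit \<Omega> f u\<^sub>0 \<noteq> {}"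
  "compactin (L1_topology \<Omega>) (omega_limit \<Omega> f u\<^sub>0)"
  "connectedin (L1_topology \<Omega>) (omega_limit \<Omega> f u\<^sub>0)"
proof -
  have "\<exists>l r. strict_mono r \<and> limitin L1.mtopology (\<lambda>k. U (t (r k))) l sequentially"
    for t :: "nat \<Rightarrow> real"
  proof -
    obtain r F where "strict_mono (r :: nat \<Rightarrow> nat)" "\<And>s. (\<lambda>k. flow (t (r k)) s) \<longlonglongrightarrow> F s"
      using pointwise_subsequence[of t] by blast
    then show ?thesis
      using limit_L1[of "\<lambda>k. t (r k)"] by blast
  qed
  note * = L1.orbit_limit_set[OF U_continuous this omega_limit_eq]
  show "omega_limit \<Omega> f u\<^sub>0 \<noteq> {}"
    "compactin (L1_topology \<Omega>) (omega_limit \<Omega> f u\<^sub>0)"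
    "connectedin (L1_topology \<Omega>) (omega_limit \<Omega> f u\<^sub>0)"
    using * by (auto simp: L1_topology_def)
qed

text \<open>A pointwise convergent subsequence and uniqueness of limits in L^1 identify
  \<open>\<Phi>\<close> with the class of \<open>F\<close> composed with \<open>u\<^sub>0\<close>.
  What is known of that function then passes to any representative \<open>\<phi>\<close>, including
  its mean.\<close>

lemma omega_limit_stationary:
  assumes "\<Phi> \<in> omega_limit \<Omega> f u\<^sub>0" and "\<phi> \<in> \<Phi>"
  shows "AE x in lebesgue_on \<Omega>. p \<le> \<phi> x \<and> \<phi> x \<le> q"
    and "AE x in lebesgue_on \<Omega>. f (\<phi> x) - mean_value \<Omega> (\<lambda>y. f (\<phi> y)) = 0"
proof -
  obtain t where t: "filterlim t at_top sequentially"
    and \<Phi>: "limitin L1.mtopology (\<lambda>k::nat. U (t k)) \<Phi> sequentially"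
    using assms(1) unfolding omega_limit_eq by blast
  obtain r F where r: "strict_mono (r :: nat \<Rightarrow> nat)" and F: "\<And>s. (\<lambda>k. flow (t (r k)) s) \<longlonglongrightarrow> F s"
    using pointwise_subsequence[of t] by blast
  have tr: "filterlim (\<lambda>k. t (r k)) at_top sequentially"
    using t r filterlim_compose filterlim_subseq by blast
  have "limitin L1.mtopology (\<lambda>k. U (t (r k))) \<Phi> sequentially"
    using limitin_subsequence[OF r \<Phi>] by (simp add: o_def)
  then have "\<Phi> = ae_class \<Omega> (\<lambda>x. F (u\<^sub>0 x))"
    by (rule L1.limitin_metric_unique[OF _ limit_L1[OF F] sequentially_bot])
  then have meas [measurable]: "\<phi> \<in> borel_measurable (lebesgue_on \<Omega>)"
    and eq: "AE x in lebesgue_on \<Omega>. \<phi> x = F (u\<^sub>0 x)"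
    using assms(2) by (auto simp: ae_class_def)
  note [measurable] = limit_measurable[OF F] borel_measurable_continuous_onI[OF f_continuous]
  show "AE x in lebesgue_on \<Omega>. p \<le> \<phi> x \<and> \<phi> x \<le> q"
    using eq by eventually_elim (simp add: limit_bounds[OF F])
  have "(LINT x|lebesgue_on \<Omega>. f (\<phi> x)) = (LINT x|lebesgue_on \<Omega>. f (F (u\<^sub>0 x)))"
    by (rule integral_cong_AE) (use eq in \<open>auto elim: eventually_mono\<close>)
  then have mean: "mean_value \<Omega> (\<lambda>y. f (\<phi> y)) = mean_value \<Omega> (\<lambda>y. f (F (u\<^sub>0 y)))"
    by (simp add: mean_value_def)
  show "AE x in lebesgue_on \<Omega>. f (\<phi> x) - mean_value \<Omega> (\<lambda>y. f (\<phi> y)) = 0"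
    using limit_stationary[OF F tr] eq by eventually_elim (simp add: mean)
qed

end

section \<open>Nonempty bounded open domains\<close>

theorem theorem1p4:
  fixes \<Omega> :: "(real ^ 'n) set"
    and f :: "real \<Rightarrow> real"
    and a b :: "nat \<Rightarrow> real"
    and u\<^sub>0 :: "real ^ 'n \<Rightarrow> real"
    and n :: nat
  assumes "open \<Omega>" and "bounded \<Omega>" and "\<Omega> \<noteq> {}"
    and f_loc_lipschitz: "\<And>s. \<exists>r>0. \<exists>L. L-lipschitz_on (cball s r) f"
    and "\<And>k. a k \<le> b k"
    and "filterlim a at_bot sequentially"
    and "filterlim b at_top sequentially"
    and "\<And>k s. s \<in> {a k..b k} \<Longrightarrow> f (a k) \<ge> f s \<and> f s \<ge> f (b k)"
    and "u\<^sub>0 \<in> Linf \<Omega>"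
    and "AE x in lebesgue_on \<Omega>. a n \<le> u\<^sub>0 x \<and> u\<^sub>0 x \<le> b n"
  shows "(\<exists>u. global_solution \<Omega> f u\<^sub>0 u \<and>
            (\<forall>v. global_solution \<Omega> f u\<^sub>0 v \<longrightarrow>
                 (\<forall>t\<ge>0. AE x in lebesgue_on \<Omega>. v t x = u t x)) \<and>
            (\<forall>t\<ge>0. (LINT x|lebesgue_on \<Omega>. u t x) = (LINT x|lebesgue_on \<Omega>. u\<^sub>0 x)) \<and>
            (\<forall>t\<ge>0. AE x in lebesgue_on \<Omega>. a n \<le> u t x \<and> u t x \<le> b n)) \<and>
         (omega_limit \<Omega> f u\<^sub>0 \<noteq> {} \<and>
          compactin (L1_topology \<Omega>) (omega_limit \<Omega> f u\<^sub>0) \<and>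
          connectedin (L1_topology \<Omega>) (omega_limit \<Omega> f u\<^sub>0)) \<and>
         (\<forall>\<Phi>\<in>omega_limit \<Omega> f u\<^sub>0. \<forall>\<phi>\<in>\<Phi>.
            (AE x in lebesgue_on \<Omega>. a n \<le> \<phi> x \<and> \<phi> x \<le> b n) \<and>
            (AE x in lebesgue_on \<Omega>. f (\<phi> x) - mean_value \<Omega> (\<lambda>y. f (\<phi> y)) = 0))"
proof -
  have lm: "\<Omega> \<in> lmeasurable"
    using \<open>open \<Omega>\<close> \<open>bounded \<Omega>\<close> by (simp add: lmeasurable_open)
  have "measure lebesgue \<Omega> \<noteq> 0"
    using lm \<open>open \<Omega>\<close> \<open>\<Omega> \<noteq> {}\<close> open_not_negligible negligible_iff_measure by blast
  then have pos: "measure lebesgue \<Omega> > 0"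
    by (simp add: less_le)
  \<comment> \<open>The truncation interval is the one between \<open>a n\<close> and
    \<open>b n\<close>, which contains almost every value of \<open>u\<^sub>0\<close>.\<close>
  interpret nonlocal_ode \<Omega> f "a n" "b n" u\<^sub>0
    using assms lm pos by unfold_locales auto
  have "(LINT x|lebesgue_on \<Omega>. u t x) = (LINT x|lebesgue_on \<Omega>. u\<^sub>0 x)" if "t \<ge> 0" for t
    by (rule solution_integral_conserved[OF \<Omega> f_continuous u_solution u0_Linf that])
  moreover have "AE x in lebesgue_on \<Omega>. a n \<le> u t x \<and> u t x \<le> b n" for t
    using flow_bounds by (simp add: u_def)
  ultimately show ?thesis
    using u_solution u_unique omega_limit_topology omega_limit_stationary by blast
qed

end
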